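(* Let $0<\alpha<1$. Suppose that $u$ satisfies, for some constant $C$ and regularity parameter $\sigma\in(0,1)\cup(1,2]$, $$\|\partial_t^m u\|_{L^2(\Omega)}\le C\,t^{\sigma-m},\qquad m=1,2.$$ Then it holds that $$|r_n|:=\left|D_\tau^\alpha u^n-\partial_{t_n}^\alpha u\right|\lesssim\begin{cases}\tau^{\sigma-\alpha}\,n^{-\min(1+\alpha,\,2-\sigma)}, & 0<\sigma<1,\\[2pt] \tau^{\sigma-\alpha}\,n^{-2+\sigma}, & 1<\sigma<2.\end{cases}$$
   Context: $\Omega=(0,L)^d\subset\mathbb{R}^d$, $d\ge1$, is the spatial domain and $u=u(x,t)$ is a function on $\Omega\times[0,T]$. The time grid is $\tau=T/N$, $t_n=n\tau$, $0\le n\le N$, with $N$ a positive integer; $u^n$ denotes the value of $u$ at time $t_n$ (the spatial variable is suppressed), and $n\ge1$ in the bound. $\partial_{t_n}^\alpha u$ is the Caputo derivative at $t=t_n$: $\partial_{t_n}^\alpha u=\frac{1}{\Gamma(1-\alpha)}\int_0^{t_n}\frac{\partial u(x,s)}{\partial s}\frac{ds}{(t_n-s)^\alpha}$. The L1 operator is $D_\tau^\alpha u^n=\frac{\tau^{-\alpha}}{\Gamma(2-\alpha)}\sum_{j=1}^n a_{n-j}(u^j-u^{j-1})$, with $a_i=(i+1)^{1-\alpha}-i^{1-\alpha}$, $i\ge0$. $A\lesssim B$ means that there is a constant $c$ with $A\le cB$; here $c$ is understood to be independent of $n$ and $\tau$.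
   Formalization: |r_n| is read as the L²(Ω) norm of r_n, since a pointwise bound does not follow from L² hypotheses, and u(x,·) is assumed continuous on [0,T], without which u⁰ would be unrelated to u at later times. *)

theory Defs
  imports "HOL-Analysis.Analysis"
begin

definition L2_space :: "'a::euclidean_space set \<Rightarrow> ('a \<Rightarrow> real) set" where
  "L2_space S = {f \<in> borel_measurable (lebesgue_on S). integrable (lebesgue_on S) (\<lambda>x. (f x)\<^sup>2)}"

text \<open>Only meaningful for \<open>f \<in> L2_space S\<close>: the Bochner integral of a non-integrable function is 0.\<close>

definition L2_norm_on :: "'a::euclidean_space set \<Rightarrow> ('a \<Rightarrow> real) \<Rightarrow> real" where
  "L2_norm_on S f = sqrt (LINT x|lebesgue_on S. (f x)\<^sup>2)"

text \<open>Lebesgue integral over the open interval, so only \<open>deriv f\<close> inside \<open>(0, t)\<close> matters. If the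
  integral diverges its value is 0; for \<open>f = u x\<close> with time derivatives bounded in \<open>L\<^sup>2\<close> by
  \<open>t powr (\<sigma> - m)\<close> this can only happen on a null set of points \<open>x\<close>.\<close>

definition caputo_deriv :: "real \<Rightarrow> (real \<Rightarrow> real) \<Rightarrow> real \<Rightarrow> real" where
  "caputo_deriv \<alpha> f t =
     1 / Gamma (1 - \<alpha>) * (LBINT s:{0<..<t}. deriv f s / (t - s) powr \<alpha>)"

definition L1_weight :: "real \<Rightarrow> nat \<Rightarrow> real" where
  "L1_weight \<alpha> i = (real i + 1) powr (1 - \<alpha>) - real i powr (1 - \<alpha>)"

text \<open>The argument \<open>v\<close> is the sequence of values on the time grid with step size \<open>\<tau>\<close>.\<close>

definition L1_operator :: "real \<Rightarrow> real \<Rightarrow> (nat \<Rightarrow> real) \<Rightarrow> nat \<Rightarrow> real" where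
  "L1_operator \<alpha> \<tau> v n =
     \<tau> powr (- \<alpha>) / Gamma (2 - \<alpha>) * (\<Sum>j=1..n. L1_weight \<alpha> (n - j) * (v j - v (j - 1)))"

text \<open>A function of the spatial variable; its size is measured in \<open>L\<^sup>2\<close>, the norm in which the
  regularity of \<open>u\<close> is assumed.\<close>

definition L1_residual ::
  "real \<Rightarrow> real \<Rightarrow> ('a \<Rightarrow> real \<Rightarrow> real) \<Rightarrow> nat \<Rightarrow> 'a \<Rightarrow> real" where
  "L1_residual \<alpha> \<tau> u n x =
     L1_operator \<alpha> \<tau> (\<lambda>j. u x (real j * \<tau>)) n - caputo_deriv \<alpha> (u x) (real n * \<tau>)"

end

theory Submission imports Defs begin

text \<open>Write \<open>k s = (t - s) powr - \<alpha>\<close> for the kernel at \<open>t = n * \<tau>\<close>. The L1 operator is what the Caputo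
derivative becomes when \<open>u\<close> is replaced by its piecewise linear interpolant, so up to the factor
\<open>1 / Gamma (1 - \<alpha>)\<close> the residual is the sum over the grid intervals \<open>{a<..<b}\<close> of the integrals of
\<open>(D - u' s) * k s\<close>, where \<open>D\<close> is the slope of the interpolant. The factor \<open>D - u' s\<close> has
integral zero over the interval, so a constant can be subtracted from \<open>k\<close> there. Subtracting
\<open>k a\<close> on every interval but the last leaves an increment of the kernel, which gains a factor
\<open>\<tau> / (t - b)\<close>.

Away from zero, \<open>D - u' s\<close> has norm at most \<open>C * \<tau> * a powr (\<sigma> - 2)\<close> by the bound on the second
derivative. The interval number \<open>j\<close> with \<open>1 < j < n\<close> therefore contributes a constant times
\<open>\<tau> powr (\<sigma> - \<alpha>) * (j - 1) powr - (2 - \<sigma>) * (n - j) powr - (1 + \<alpha>)\<close>. Only the first derivative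
is used on the first interval, whose contribution decays like \<open>n powr - (1 + \<alpha>)\<close>, the rate of the
kernel; on the last one the kernel itself is integrated, and the contribution decays like
\<open>n powr - (2 - \<sigma>)\<close>, the rate of the second derivative. The convolution of the two powers decays
like the slower one (\<open>powr_convolution_le\<close>) because \<open>1 + \<alpha> > 1\<close>. This gives the single rate
\<open>min (1 + \<alpha>) (2 - \<sigma>)\<close> for all \<open>\<sigma>\<close> between 0 and 2, and it is equal to \<open>2 - \<sigma>\<close> if \<open>\<sigma> > 1\<close>.

All bounds are bounds of \<open>L\<^sup>2\<close> norms in space, so every passage from an integrand to an integral is
an instance of Minkowski's integral inequality (\<open>L2_bound_set_integral\<close>). That inequality also
supplies the regularity in time: for almost every point of space the derivatives are integrable
in time, and there an integrable derivative, continuous or not, integrates to the increment. The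
inequality requires joint measurability in space and time, which follows from
measurability in space because \<open>u'\<close> is continuous in time and \<open>u''\<close> is a limit of difference
quotients of \<open>u'\<close>.\<close>

section \<open>Square integrable functions and Minkowski's integral inequality\<close>

text \<open>An \<open>L\<^sup>2\<close> norm bound. Stated with the nonnegative integral it includes square integrability. The
bound is strictly positive because Minkowski's inequality is proved below by dividing by it.\<close>

definition L2_bound :: "'a measure \<Rightarrow> ('a \<Rightarrow> real) \<Rightarrow> real \<Rightarrow> bool" where
  "L2_bound M f B \<longleftrightarrow>
     0 < B \<and> f \<in> borel_measurable M \<and> (\<integral>\<^sup>+x. ennreal ((f x)\<^sup>2) \<partial>M) \<le> ennreal (B\<^sup>2)"

lemma L2_boundD:
  assumes "L2_bound M f B"
  shows "0 < B" "f \<in> borel_measurable M" "(\<integral>\<^sup>+x. ennreal ((f x)\<^sup>2) \<partial>M) \<le> ennreal (B\<^sup>2)"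
  using assms by (auto simp: L2_bound_def)

lemma L2_bound_mono:
  assumes "L2_bound M f B" "B \<le> B'"
  shows "L2_bound M f B'"
proof -
  have "ennreal (B\<^sup>2) \<le> ennreal (B'\<^sup>2)"
    using assms by (intro ennreal_leI power_mono) (auto simp: L2_bound_def)
  then show ?thesis
    using assms by (auto simp: L2_bound_def intro: order_trans)
qed

lemma L2_bound_cong_AE:
  assumes f: "L2_bound M f B" and g: "g \<in> borel_measurable M" and eq: "AE x in M. f x = g x"
  shows "L2_bound M g B"
proof -
  have "(\<integral>\<^sup>+x. ennreal ((g x)\<^sup>2) \<partial>M) = (\<integral>\<^sup>+x. ennreal ((f x)\<^sup>2) \<partial>M)"
    using eq by (intro nn_integral_cong_AE) auto
  then show ?thesis using f g by (simp add: L2_bound_def)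
qed

lemma L2_bound_cmult:
  assumes f: "L2_bound M f B" and c: "c \<noteq> 0"
  shows "L2_bound M (\<lambda>x. c * f x) (\<bar>c\<bar> * B)"
proof -
  note [measurable] = L2_boundD(2)[OF f]
  have "(\<integral>\<^sup>+x. ennreal ((c * f x)\<^sup>2) \<partial>M) = (\<integral>\<^sup>+x. ennreal (c\<^sup>2) * ennreal ((f x)\<^sup>2) \<partial>M)"
    by (simp add: power_mult_distrib ennreal_mult)
  also have "\<dots> = ennreal (c\<^sup>2) * (\<integral>\<^sup>+x. ennreal ((f x)\<^sup>2) \<partial>M)"
    by (rule nn_integral_cmult) simp
  also have "\<dots> \<le> ennreal (c\<^sup>2) * ennreal (B\<^sup>2)"
    by (rule mult_left_mono[OF L2_boundD(3)[OF f]]) simp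
  also have "\<dots> = ennreal ((\<bar>c\<bar> * B)\<^sup>2)"
    by (simp add: power_mult_distrib ennreal_mult)
  finally show ?thesis
    using L2_boundD(1)[OF f] c by (auto simp: L2_bound_def)
qed

text \<open>The triangle inequality without Cauchy--Schwarz: the weights in Young's inequality are chosen from
the two bounds so that the result is exactly \<open>(A + B)\<^sup>2\<close>.\<close>

lemma L2_bound_add:
  assumes f: "L2_bound M f A" and g: "L2_bound M g B"
  shows "L2_bound M (\<lambda>x. f x + g x) (A + B)"
proof -
  note [measurable] = L2_boundD(2)[OF f] L2_boundD(2)[OF g]
  have A: "0 < A" and B: "0 < B" using f g by (auto simp: L2_bound_def)
  have young: "(y + z)\<^sup>2 \<le> (1 + B / A) * y\<^sup>2 + (1 + A / B) * z\<^sup>2" for y z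
  proof -
    have "(1 + B / A) * y\<^sup>2 + (1 + A / B) * z\<^sup>2 - (y + z)\<^sup>2 = (B * y - A * z)\<^sup>2 / (A * B)"
      using A B by (simp add: field_simps power2_eq_square)
    also have "\<dots> \<ge> 0" using A B by simp
    finally show ?thesis by simp
  qed
  have "(\<integral>\<^sup>+x. ennreal ((f x + g x)\<^sup>2) \<partial>M)
      \<le> (\<integral>\<^sup>+x. ennreal (1 + B / A) * ennreal ((f x)\<^sup>2) + ennreal (1 + A / B) * ennreal ((g x)\<^sup>2) \<partial>M)"
    using A B young
    by (intro nn_integral_mono) (simp flip: ennreal_mult' ennreal_plus)
  also have "\<dots> = ennreal (1 + B / A) * (\<integral>\<^sup>+x. ennreal ((f x)\<^sup>2) \<partial>M)
                + ennreal (1 + A / B) * (\<integral>\<^sup>+x. ennreal ((g x)\<^sup>2) \<partial>M)"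
    by (simp add: nn_integral_add nn_integral_cmult)
  also have "\<dots> \<le> ennreal (1 + B / A) * ennreal (A\<^sup>2) + ennreal (1 + A / B) * ennreal (B\<^sup>2)"
    by (intro add_mono mult_left_mono L2_boundD(3)[OF f] L2_boundD(3)[OF g]) auto
  also have "\<dots> = ennreal ((A + B)\<^sup>2)"
  proof -
    have "(1 + B / A) * A\<^sup>2 + (1 + A / B) * B\<^sup>2 = (A + B)\<^sup>2"
      using A B by (simp add: field_simps power2_eq_square)
    then show ?thesis using A B by (simp flip: ennreal_mult' ennreal_plus)
  qed
  finally show ?thesis using A B by (simp add: L2_bound_def)
qed

lemma L2_bound_sum:
  assumes "finite I" "I \<noteq> {}" "\<And>i. i \<in> I \<Longrightarrow> L2_bound M (f i) (B i)"
  shows "L2_bound M (\<lambda>x. \<Sum>i\<in>I. f i x) (\<Sum>i\<in>I. B i)"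
  using assms
proof (induction rule: finite_ne_induct)
  case (insert i F)
  have "L2_bound M (\<lambda>x. f i x + (\<Sum>i\<in>F. f i x)) (B i + (\<Sum>i\<in>F. B i))"
    using insert by (intro L2_bound_add) auto
  then show ?case using insert by simp
qed auto

text \<open>Minkowski's integral inequality, in the form in which a bound \<open>w s\<close> for the norm of each slice is
known. Cauchy--Schwarz with the weight \<open>w\<close> gives
\<open>(\<integral>|f x s| ds)\<^sup>2 \<le> (\<integral>(f x s)\<^sup>2 / w s ds) * \<integral>w\<close>; integrating over \<open>x\<close> and exchanging the integrals
bounds the first factor by \<open>\<integral>(w s)\<^sup>2 / w s ds = \<integral>w\<close>. The same estimate shows that almost every
\<open>f x\<close> is integrable.\<close>

lemma L2_bound_set_integral:
  fixes f :: "'a \<Rightarrow> 'b \<Rightarrow> real"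
  assumes M: "sigma_finite_measure M" and N: "sigma_finite_measure N"
    and f[measurable]: "(\<lambda>(x, s). f x s) \<in> borel_measurable (M \<Otimes>\<^sub>M N)"
    and A[measurable]: "A \<in> sets N"
    and bound: "\<And>s. s \<in> A \<Longrightarrow> L2_bound M (\<lambda>x. f x s) (w s)"
    and w: "set_integrable N A w" and W: "(LINT s:A|N. w s) = I" and pos: "0 < I"
  shows "AE x in M. set_integrable N A (f x)"
    and "L2_bound M (\<lambda>x. LINT s:A|N. f x s) I"
proof -
  interpret M: sigma_finite_measure M by fact
  interpret N: sigma_finite_measure N by fact
  interpret P: pair_sigma_finite M N ..
  define wA where "wA s = indicat_real A s * w s" for s
  define F where "F x s = indicat_real A s * f x s" for x s
  have Wint: "integrable N wA" using w unfolding wA_def set_integrable_def by simp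
  then have wA[measurable]: "wA \<in> borel_measurable N" by auto
  have F[measurable]: "(\<lambda>(x, s). F x s) \<in> borel_measurable (M \<Otimes>\<^sub>M N)"
    unfolding F_def by measurable
  have Wpos: "wA s > 0" if "s \<in> A" for s
    using L2_boundD(1)[OF bound[OF that]] that by (simp add: wA_def)
  have W0: "wA s \<ge> 0" for s using Wpos[of s] by (cases "s \<in> A") (auto simp: wA_def)
  have I: "(\<integral>\<^sup>+s. ennreal (wA s) \<partial>N) = ennreal I"
    using nn_integral_eq_integral[OF Wint] W0
    W unfolding set_lebesgue_integral_def by (simp add: wA_def[abs_def])
  \<comment> \<open>Cauchy--Schwarz for the product of \<open>\<bar>F x s\<bar> / sqrt (wA s)\<close> and
    \<open>sqrt (wA s)\<close>. Outside \<open>A\<close> both \<open>F x\<close> and \<open>wA\<close> vanish,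
    and the quotient is \<open>0 / 0 = 0\<close>.\<close>
  have CS: "(\<integral>\<^sup>+s. ennreal \<bar>F x s\<bar> \<partial>N)\<^sup>2 \<le> (\<integral>\<^sup>+s. ennreal ((F x s)\<^sup>2 / wA s) \<partial>N) * ennreal I"
    if x: "x \<in> space M" for x
  proof -
    have [measurable]: "F x \<in> borel_measurable N"
      using measurable_compose[OF measurable_Pair1'[OF x] F] by simp
    have "ennreal \<bar>F x s\<bar> = ennreal (\<bar>F x s\<bar> / sqrt (wA s)) * ennreal (sqrt (wA s))" for s
      using W0[of s] Wpos[of s] by (cases "s \<in> A") (auto simp: F_def simp flip: ennreal_mult')
    moreover have "(ennreal (\<bar>F x s\<bar> / sqrt (wA s)))\<^sup>2 = ennreal ((F x s)\<^sup>2 / wA s)"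
      "(ennreal (sqrt (wA s)))\<^sup>2 = ennreal (wA s)" for s
      using W0[of s] by (simp_all add: ennreal_power power_divide)
    ultimately show ?thesis
      using Cauchy_Schwarz_nn_integral[of "\<lambda>s. ennreal (\<bar>F x s\<bar> / sqrt (wA s))" N "\<lambda>s. ennreal (sqrt (wA s))"] I
      by simp
  qed
  have ineq: "(\<integral>\<^sup>+x. (\<integral>\<^sup>+s. ennreal \<bar>F x s\<bar> \<partial>N)\<^sup>2 \<partial>M) \<le> ennreal (I\<^sup>2)"
  proof -
    have "(\<integral>\<^sup>+x. (\<integral>\<^sup>+s. ennreal \<bar>F x s\<bar> \<partial>N)\<^sup>2 \<partial>M)
        \<le> (\<integral>\<^sup>+x. (\<integral>\<^sup>+s. ennreal ((F x s)\<^sup>2 / wA s) \<partial>N) * ennreal I \<partial>M)"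
      by (intro nn_integral_mono CS)
    also have "\<dots> = (\<integral>\<^sup>+x. (\<integral>\<^sup>+s. ennreal ((F x s)\<^sup>2 / wA s) \<partial>N) \<partial>M) * ennreal I"
      by (rule nn_integral_multc) measurable
    also have "(\<integral>\<^sup>+x. (\<integral>\<^sup>+s. ennreal ((F x s)\<^sup>2 / wA s) \<partial>N) \<partial>M)
        = (\<integral>\<^sup>+s. (\<integral>\<^sup>+x. ennreal ((F x s)\<^sup>2 / wA s) \<partial>M) \<partial>N)"
      by (rule P.Fubini'[symmetric]) measurable
    also have "\<dots> \<le> (\<integral>\<^sup>+s. ennreal (wA s) \<partial>N)"
    proof (rule nn_integral_mono)
      fix s
      show "(\<integral>\<^sup>+x. ennreal ((F x s)\<^sup>2 / wA s) \<partial>M) \<le> ennreal (wA s)"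
      proof (cases "s \<in> A")
        case True
        note [measurable] = L2_boundD(2)[OF bound[OF True]]
        have "(\<integral>\<^sup>+x. ennreal ((F x s)\<^sup>2 / wA s) \<partial>M)
            = (\<integral>\<^sup>+x. ennreal ((f x s)\<^sup>2) * ennreal (1 / w s) \<partial>M)"
          using True Wpos[OF True]
          by (intro nn_integral_cong) (simp add: F_def wA_def flip: ennreal_mult')
        also have "\<dots> = (\<integral>\<^sup>+x. ennreal ((f x s)\<^sup>2) \<partial>M) * ennreal (1 / w s)"
          by (rule nn_integral_multc) measurable
        also have "\<dots> \<le> ennreal ((w s)\<^sup>2) * ennreal (1 / w s)"
          by (intro mult_right_mono L2_boundD(3)[OF bound[OF True]]) auto
        also have "\<dots> = ennreal (wA s)"
          using True Wpos[OF True] by (simp add: wA_def power2_eq_square flip: ennreal_mult')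
        finally show ?thesis .
      qed (simp add: F_def)
    qed
    also note I
    also have "ennreal I * ennreal I = ennreal (I\<^sup>2)"
      using pos by (simp add: power2_eq_square flip: ennreal_mult')
    finally show ?thesis by (simp add: mult_right_mono)
  qed
  have "AE x in M. (\<integral>\<^sup>+s. ennreal \<bar>F x s\<bar> \<partial>N)\<^sup>2 \<noteq> \<infinity>"
    using ineq by (intro nn_integral_PInf_AE) (auto simp: top_unique)
  then show "AE x in M. set_integrable N A (f x)"
  proof (rule AE_mp, intro AE_I2 impI)
    fix x assume x: "x \<in> space M" and fin: "(\<integral>\<^sup>+s. ennreal \<bar>F x s\<bar> \<partial>N)\<^sup>2 \<noteq> \<infinity>"
    have [measurable]: "F x \<in> borel_measurable N"
      using measurable_compose[OF measurable_Pair1'[OF x] F] by simp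
    from fin have "(\<integral>\<^sup>+s. ennreal (norm (F x s)) \<partial>N) < \<infinity>"
      by (auto simp: top.not_eq_extremum power2_eq_square ennreal_mult_eq_top_iff)
    then have "integrable N (F x)" by (intro integrableI_bounded) auto
    then show "set_integrable N A (f x)" by (simp add: set_integrable_def F_def[abs_def])
  qed
  have meas[measurable]: "(\<lambda>x. LINT s|N. F x s) \<in> borel_measurable M" by measurable
  have "(\<integral>\<^sup>+x. ennreal ((LINT s|N. F x s)\<^sup>2) \<partial>M) \<le> (\<integral>\<^sup>+x. (\<integral>\<^sup>+s. ennreal \<bar>F x s\<bar> \<partial>N)\<^sup>2 \<partial>M)"
  proof (rule nn_integral_mono)
    fix x assume x: "x \<in> space M"
    show "ennreal ((LINT s|N. F x s)\<^sup>2) \<le> (\<integral>\<^sup>+s. ennreal \<bar>F x s\<bar> \<partial>N)\<^sup>2"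
    proof (cases "integrable N (F x)")
      case True
      have "ennreal ((LINT s|N. F x s)\<^sup>2) = (ennreal \<bar>LINT s|N. F x s\<bar>)\<^sup>2"
        by (simp add: ennreal_power)
      also have "\<dots> \<le> (\<integral>\<^sup>+s. ennreal \<bar>F x s\<bar> \<partial>N)\<^sup>2"
        using integral_norm_bound_ennreal[OF True] by (intro power_mono) auto
      finally show ?thesis .
    qed (simp add: not_integrable_integral_eq)
  qed
  also note ineq
  finally show "L2_bound M (\<lambda>x. LINT s:A|N. f x s) I"
    using pos meas by (simp add: L2_bound_def F_def set_lebesgue_integral_def)
qed

section \<open>Integrals over open intervals\<close>

text \<open>The gauge integral of a derivative always exists, and it is the Lebesgue integral as soon as the
latter exists. So integrability takes the place of the usual continuity of the derivative.\<close>

lemma set_integral_FTC: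
  fixes F f :: "real \<Rightarrow> real"
  assumes "a \<le> b" "continuous_on {a..b} F"
    and deriv: "\<And>x. x \<in> {a<..<b} \<Longrightarrow> (F has_real_derivative f x) (at x)"
    and int: "set_integrable lborel {a<..<b} f"
  shows "(LBINT x:{a<..<b}. f x) = F b - F a"
proof -
  have "(f has_integral (F b - F a)) {a..b}"
    using assms
    by (intro fundamental_theorem_of_calculus_interior)
       (auto simp: has_real_derivative_iff_has_vector_derivative)
  then have "(f has_integral (F b - F a)) {a<..<b}"
    by (simp add: has_integral_Icc_iff_Ioo)
  then show ?thesis
    using set_borel_integral_eq_integral(2)[OF int] by (simp add: integral_unique)
qed

lemma set_integrable_FTC_nonneg:
  fixes F f :: "real \<Rightarrow> real"
  assumes "a \<le> b" "continuous_on {a..b} F"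
    and deriv: "\<And>x. x \<in> {a<..<b} \<Longrightarrow> (F has_real_derivative f x) (at x)"
    and nonneg: "\<And>x. x \<in> {a<..<b} \<Longrightarrow> 0 \<le> f x"
    and [measurable]: "f \<in> borel_measurable borel"
  shows "set_integrable lborel {a<..<b} f"
proof -
  have "(f has_integral (F b - F a)) {a..b}"
    using assms
    by (intro fundamental_theorem_of_calculus_interior)
       (auto simp: has_real_derivative_iff_has_vector_derivative)
  then have "f integrable_on {a<..<b}"
    by (auto simp: has_integral_Icc_iff_Ioo)
  then have "f absolutely_integrable_on {a<..<b}"
    using nonneg by (rule nonnegative_absolutely_integrable_1)
  then show ?thesis
    unfolding set_integrable_def by (subst (asm) integrable_completion) auto
qed

lemma set_integral_Ioo_const:
  fixes a b c :: real
  shows "set_integrable lborel {a<..<b} (\<lambda>_. c)"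
    and "a \<le> b \<Longrightarrow> (LBINT s:{a<..<b}. c) = (b - a) * c"
proof -
  have "emeasure lborel {a<..<b} < \<infinity>" by (cases "a \<le> b") auto
  then show "set_integrable lborel {a<..<b} (\<lambda>_. c)"
    by (simp add: set_integrable_def)
  show "(LBINT s:{a<..<b}. c) = (b - a) * c" if "a \<le> b"
    using that by (simp add: set_lebesgue_integral_def)
qed

text \<open>The singularity of the first derivative at time zero is integrable.\<close>

lemma power_singularity_integral:
  fixes \<sigma> b :: real
  assumes "0 < \<sigma>" "0 \<le> b"
  shows "set_integrable lborel {0<..<b} (\<lambda>s. s powr (\<sigma> - 1))"
    and "(LBINT s:{0<..<b}. s powr (\<sigma> - 1)) = b powr \<sigma> / \<sigma>"
proof -
  have cont: "continuous_on {0..b} (\<lambda>s. s powr \<sigma> / \<sigma>)"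
    using assms by (intro continuous_intros continuous_on_powr') auto
  have deriv: "((\<lambda>s. s powr \<sigma> / \<sigma>) has_real_derivative s powr (\<sigma> - 1)) (at s)"
    if "s \<in> {0<..<b}" for s
    using that assms by (auto intro!: derivative_eq_intros simp: powr_diff)
  show int: "set_integrable lborel {0<..<b} (\<lambda>s. s powr (\<sigma> - 1))"
    using assms cont deriv by (intro set_integrable_FTC_nonneg) auto
  show "(LBINT s:{0<..<b}. s powr (\<sigma> - 1)) = b powr \<sigma> / \<sigma>"
    using set_integral_FTC[OF \<open>0 \<le> b\<close> cont deriv int] assms by simp
qed

text \<open>Over the grid intervals these integrals are, up to a factor, the weights of the L1 operator.\<close>

lemma abel_kernel_integral:
  fixes \<alpha> a b t :: real
  assumes "\<alpha> < 1" "a \<le> b" "b \<le> t"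
  shows "set_integrable lborel {a<..<b} (\<lambda>s. (t - s) powr (- \<alpha>))"
    and "(LBINT s:{a<..<b}. (t - s) powr (- \<alpha>))
           = ((t - a) powr (1 - \<alpha>) - (t - b) powr (1 - \<alpha>)) / (1 - \<alpha>)"
proof -
  have cont: "continuous_on {a..b} (\<lambda>s. - ((t - s) powr (1 - \<alpha>) / (1 - \<alpha>)))"
    using assms by (intro continuous_intros continuous_on_powr') auto
  have deriv: "((\<lambda>s. - ((t - s) powr (1 - \<alpha>) / (1 - \<alpha>))) has_real_derivative (t - s) powr (- \<alpha>)) (at s)"
    if "s \<in> {a<..<b}" for s
  proof -
    have "((\<lambda>y. y powr (1 - \<alpha>)) has_real_derivative (1 - \<alpha>) * (t - s) powr (1 - \<alpha> - 1)) (at (t - s))"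
      using that assms by (intro has_real_derivative_powr) auto
    then have "((\<lambda>s. (t - s) powr (1 - \<alpha>)) has_real_derivative
        (1 - \<alpha>) * (t - s) powr (1 - \<alpha> - 1) * (- 1)) (at s)"
      by (rule DERIV_chain2) (auto intro!: derivative_eq_intros)
    from DERIV_minus[OF DERIV_cdivide[OF this, of "1 - \<alpha>"]] show ?thesis
      using assms by simp
  qed
  show int: "set_integrable lborel {a<..<b} (\<lambda>s. (t - s) powr (- \<alpha>))"
    using assms cont deriv by (intro set_integrable_FTC_nonneg) auto
  show "(LBINT s:{a<..<b}. (t - s) powr (- \<alpha>))
           = ((t - a) powr (1 - \<alpha>) - (t - b) powr (1 - \<alpha>)) / (1 - \<alpha>)"
    using set_integral_FTC[OF \<open>a \<le> b\<close> cont deriv int] assms by (simp add: diff_divide_distrib)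
qed

text \<open>Each of the two singularities is harmless on the half of the interval away from it, so the
integrand of the Beta integral is dominated by a sum of integrable powers.\<close>

lemma beta_integrand_bound:
  fixes \<alpha> \<sigma> s t :: real
  assumes "0 < \<alpha>" "0 < \<sigma>" "0 < s" "s < t"
  shows "s powr (\<sigma> - 1) * (t - s) powr (- \<alpha>)
    \<le> (t / 2) powr (- \<alpha>) * s powr (\<sigma> - 1) + 2 * t powr (\<sigma> - 1) * (t - s) powr (- \<alpha>)"
proof (cases "s \<le> t / 2")
  case True
  then have "(t - s) powr (- \<alpha>) \<le> (t / 2) powr (- \<alpha>)"
    using assms by (intro powr_mono2') auto
  then have "s powr (\<sigma> - 1) * (t - s) powr (- \<alpha>) \<le> (t / 2) powr (- \<alpha>) * s powr (\<sigma> - 1)"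
    by (simp add: mult.commute mult_left_mono)
  then show ?thesis by (simp add: add_increasing2)
next
  case False
  have "s powr (\<sigma> - 1) \<le> 2 * t powr (\<sigma> - 1)"
  proof (cases "\<sigma> < 1")
    case True
    have "s powr (\<sigma> - 1) \<le> (t / 2) powr (\<sigma> - 1)"
      using False True assms by (intro powr_mono2') auto
    also have "\<dots> = 2 powr (1 - \<sigma>) * t powr (\<sigma> - 1)"
      using assms by (simp add: powr_divide powr_diff field_simps)
    also have "\<dots> \<le> 2 * t powr (\<sigma> - 1)"
      using powr_mono[of "1 - \<sigma>" 1 "2::real"] assms by (intro mult_right_mono) auto
    finally show ?thesis .
  next
    case ge: False
    have "s powr (\<sigma> - 1) \<le> t powr (\<sigma> - 1)"
      using ge assms by (intro powr_mono2) auto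
    also have "\<dots> \<le> 2 * t powr (\<sigma> - 1)" by simp
    finally show ?thesis .
  qed
  then have "s powr (\<sigma> - 1) * (t - s) powr (- \<alpha>) \<le> 2 * t powr (\<sigma> - 1) * (t - s) powr (- \<alpha>)"
    by (intro mult_right_mono) auto
  then show ?thesis by (simp add: add_increasing)
qed

lemma set_integral_split_Ioo:
  fixes f :: "real \<Rightarrow> real"
  assumes int: "set_integrable lborel {a<..<c} f" and "a \<le> b" "b \<le> c"
  shows "(LBINT s:{a<..<c}. f s) = (LBINT s:{a<..<b}. f s) + (LBINT s:{b<..<c}. f s)"
proof -
  have 1: "set_integrable lborel {a<..<b} f" "set_integrable lborel {b<..<c} f"
    using assms by (auto intro: set_integrable_subset[OF int])
  have "(LBINT s:{a<..<c}. f s) = (LBINT s:{a<..<b} \<union> {b<..<c}. f s)"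
  proof (rule set_integral_cong_set)
    show "set_borel_measurable lborel {a<..<c} f"
      using int by (auto simp: set_integrable_def set_borel_measurable_def)
    show "set_borel_measurable lborel ({a<..<b} \<union> {b<..<c}) f"
      using set_integrable_Un[OF 1] by (auto simp: set_integrable_def set_borel_measurable_def)
    show "AE s in lborel. (s \<in> {a<..<b} \<union> {b<..<c}) = (s \<in> {a<..<c})"
      using AE_lborel_singleton[of b] by (rule AE_mp) (use assms in \<open>auto intro!: AE_I2\<close>)
  qed
  also have "\<dots> = (LBINT s:{a<..<b}. f s) + (LBINT s:{b<..<c}. f s)"
    using 1 by (intro set_integral_Un) auto
  finally show ?thesis .
qed

lemma set_integral_grid:
  fixes f :: "real \<Rightarrow> real"
  assumes "0 \<le> \<tau>" "set_integrable lborel {0<..<real n * \<tau>} f"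
  shows "(LBINT s:{0<..<real n * \<tau>}. f s)
           = (\<Sum>j=1..n. LBINT s:{real (j - 1) * \<tau><..<real j * \<tau>}. f s)"
  using assms(2)
proof (induction n)
  case (Suc n)
  have le: "0 \<le> real n * \<tau>" "real n * \<tau> \<le> real (Suc n) * \<tau>"
    using assms(1) by (auto intro: mult_right_mono)
  have "set_integrable lborel {0<..<real n * \<tau>} f"
    by (rule set_integrable_subset[OF Suc.prems]) (use le in auto)
  then show ?case
    using Suc.IH set_integral_split_Ioo[OF Suc.prems le] by simp
qed (simp add: set_lebesgue_integral_def)

text \<open>A function that is measurable in one variable and right continuous in the other is jointly
measurable, as the limit of the functions obtained by rounding the second variable up to a grid.\<close>

lemma borel_measurable_pair_right_continuous:
  fixes g :: "'a \<Rightarrow> real \<Rightarrow> real"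
  assumes meas: "\<And>s. (\<lambda>x. g x s) \<in> borel_measurable M"
    and A[measurable]: "A \<in> sets borel"
    and cont: "\<And>x s. x \<in> space M \<Longrightarrow> s \<in> A \<Longrightarrow> continuous (at_right s) (g x)"
    and zero: "\<And>x s. s \<notin> A \<Longrightarrow> g x s = 0"
  shows "(\<lambda>(x, s). g x s) \<in> borel_measurable (M \<Otimes>\<^sub>M lborel)"
proof (rule borel_measurable_LIMSEQ_real)
  \<comment> \<open>The next grid point strictly to the right of \<open>s\<close>, at spacing \<open>1 / Suc
    k\<close>.\<close>
  define \<theta> where "\<theta> k s = (of_int \<lfloor>real (Suc k) * s\<rfloor> + 1) / real (Suc k)" for k :: nat and s :: real
  define G where "G k p = indicat_real A (snd p) * g (fst p) (\<theta> k (snd p))" for k and p :: "'a \<times> real"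
  have \<theta>_gt: "s < \<theta> k s" for k s
    unfolding \<theta>_def by (subst less_divide_eq) (auto simp: mult.commute)
  have \<theta>_le: "\<theta> k s \<le> s + 1 / real (Suc k)" for k s
  proof -
    have "of_int \<lfloor>real (Suc k) * s\<rfloor> + 1 \<le> real (Suc k) * s + 1" by simp
    also have "\<dots> = (s + 1 / real (Suc k)) * real (Suc k)" by (simp add: field_simps)
    finally show ?thesis unfolding \<theta>_def by (subst pos_divide_le_eq) auto
  qed
  have \<theta>_lim: "filterlim (\<lambda>k. \<theta> k s) (at_right s) sequentially" for s
  proof -
    have "(\<lambda>k. s + 1 / real (Suc k)) \<longlonglongrightarrow> s + 0"
      by (intro tendsto_intros LIMSEQ_inverse_real_of_nat[unfolded inverse_eq_divide])
    then have "(\<lambda>k. \<theta> k s) \<longlonglongrightarrow> s"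
      using \<theta>_gt[of s] \<theta>_le[of _ s]
      by (intro tendsto_sandwich[of "\<lambda>_. s" "\<lambda>k. \<theta> k s" _ "\<lambda>k. s + 1 / real (Suc k)"])
         (auto intro!: always_eventually less_imp_le)
    moreover have "\<theta> k s \<noteq> s" for k using \<theta>_gt[of s k] by simp
    ultimately show ?thesis
      using \<theta>_gt by (simp add: filterlim_at)
  qed
  show "(\<lambda>k. G k p) \<longlonglongrightarrow> (case p of (x, s) \<Rightarrow> g x s)" if "p \<in> space (M \<Otimes>\<^sub>M lborel)" for p
  proof -
    obtain x s where p: "p = (x, s)" by (cases p)
    with that have x: "x \<in> space M" by (simp add: space_pair_measure)
    show ?thesis
    proof (cases "s \<in> A")
      case True
      then have "(g x \<longlongrightarrow> g x s) (at_right s)"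
        using cont[OF x] by (simp add: continuous_within)
      from filterlim_compose[OF this \<theta>_lim] True show ?thesis by (simp add: p G_def)
    qed (use zero in \<open>simp add: p G_def\<close>)
  qed
  show "G k \<in> borel_measurable (M \<Otimes>\<^sub>M lborel)" for k
  proof -
    have "(\<lambda>p. g (fst p) ((of_int i + 1) / real (Suc k))) \<in> borel_measurable (M \<Otimes>\<^sub>M lborel)" for i :: int
      by (rule measurable_compose[OF measurable_fst meas])
    moreover have "(\<lambda>p. \<lfloor>real (Suc k) * snd p\<rfloor>) \<in> measurable (M \<Otimes>\<^sub>M lborel) (count_space UNIV)"
      by measurable
    ultimately have [measurable]: "(\<lambda>p. g (fst p) (\<theta> k (snd p))) \<in> borel_measurable (M \<Otimes>\<^sub>M lborel)"
      unfolding \<theta>_def by (rule measurable_compose_countable)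
    show ?thesis unfolding G_def by measurable
  qed
qed

section \<open>Powers, their convolution and the increments of the kernel\<close>

text \<open>The larger of \<open>i\<close> and \<open>m\<close> is at least their mean and carries at least the exponent \<open>min p q\<close>. If
its exponent is \<open>p > q\<close>, the excess is moved to the smaller number, which then carries \<open>p\<close>. The
two summands on the right cover both cases.\<close>

lemma powr_product_le:
  fixes i m p q :: real
  assumes i: "1 \<le> i" and m: "1 \<le> m" and p: "0 \<le> p" and q: "0 \<le> q"
  shows "i powr (- q) * m powr (- p)
    \<le> ((i + m) / 2) powr (- min p q) * (i powr (- p) + m powr (- p))"
proof -
  define h where "h = (i + m) / 2"
  have h: "0 < h" using i m by (simp add: h_def)
  show ?thesis
  proof (cases "i \<le> m")
    case True
    then have hm: "h \<le> m" by (simp add: h_def)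
    have "i powr (- q) * m powr (- p) \<le> i powr (- p) * h powr (- min p q)"
    proof (cases "p \<le> q")
      case True
      then have "min p q = p" by simp
      then show ?thesis
        using True i hm h p by (simp only:) (intro mult_mono powr_mono powr_mono2'; simp)
    next
      case False
      have "i powr (- q) * m powr (- p) = i powr (- q) * m powr (- (p - q)) * m powr (- q)"
        by (simp add: mult.assoc flip: powr_add)
      also have "\<dots> \<le> i powr (- q) * i powr (- (p - q)) * h powr (- q)"
        using False \<open>i \<le> m\<close> i hm h q by (intro mult_mono powr_mono2') auto
      also have "\<dots> = i powr (- p) * h powr (- min p q)"
        using False by (simp flip: powr_add)
      finally show ?thesis .
    qed
    also have "\<dots> \<le> (i powr (- p) + m powr (- p)) * h powr (- min p q)"
      by (intro mult_right_mono) auto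
    finally show ?thesis by (simp add: h_def mult.commute)
  next
    case False
    then have hi: "h \<le> i" by (simp add: h_def)
    have "i powr (- q) \<le> i powr (- min p q)"
      using i by (intro powr_mono) auto
    also have "\<dots> \<le> h powr (- min p q)"
      using hi h p q by (intro powr_mono2') auto
    finally have "i powr (- q) * m powr (- p) \<le> h powr (- min p q) * m powr (- p)"
      by (intro mult_right_mono) auto
    also have "\<dots> \<le> h powr (- min p q) * (i powr (- p) + m powr (- p))"
      by (intro mult_left_mono) auto
    finally show ?thesis by (simp add: h_def)
  qed
qed

lemma summable_Suc_powr: "1 < p \<Longrightarrow> summable (\<lambda>k. real (Suc k) powr (- p))"
  by (subst summable_Suc_iff) (simp add: summable_real_powr_iff)

lemma divide_powr_minus:
  fixes x k p :: real
  assumes "0 \<le> x" "0 < k"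
  shows "(x / k) powr (- p) = k powr p * x powr (- p)"
  using assms by (simp add: powr_divide powr_minus_divide)

text \<open>The sum of \<open>i powr - p\<close> converges for \<open>p > 1\<close>, so by the previous estimate the convolution decays
like the slower of its two factors. Nothing is lost if \<open>q \<le> 1\<close>, although the sum of
\<open>i powr - q\<close> then diverges.\<close>

lemma powr_convolution_le:
  fixes p q :: real and N :: nat
  assumes p: "1 < p" and q: "0 \<le> q"
  shows "(\<Sum>i=1..<N. real i powr (- q) * real (N - i) powr (- p))
    \<le> 2 * (\<Sum>k. real (Suc k) powr (- p)) * (real N / 2) powr (- min p q)"
proof -
  define Z where "Z = (\<Sum>k. real (Suc k) powr (- p))"
  note summ = summable_Suc_powr[OF p]
  have Z: "(\<Sum>i=1..<N. real i powr (- p)) \<le> Z"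
  proof -
    have "(\<Sum>i=1..<N. real i powr (- p)) = (\<Sum>k<N - 1. real (Suc k) powr (- p))"
      by (rule sum.reindex_bij_witness[of _ Suc "\<lambda>i. i - 1"]) auto
    also have "\<dots> \<le> Z" unfolding Z_def by (rule sum_le_suminf[OF summ]) auto
    finally show ?thesis .
  qed
  have "(\<Sum>i=1..<N. real i powr (- q) * real (N - i) powr (- p))
      \<le> (\<Sum>i=1..<N. (real N / 2) powr (- min p q) * (real i powr (- p) + real (N - i) powr (- p)))"
  proof (rule sum_mono)
    fix i assume "i \<in> {1..<N}"
    then show "real i powr (- q) * real (N - i) powr (- p)
      \<le> (real N / 2) powr (- min p q) * (real i powr (- p) + real (N - i) powr (- p))"
      using powr_product_le[of "real i" "real (N - i)" p q] p q by (auto simp: of_nat_diff)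
  qed
  also have "\<dots> = (real N / 2) powr (- min p q) *
      ((\<Sum>i=1..<N. real i powr (- p)) + (\<Sum>i=1..<N. real (N - i) powr (- p)))"
    by (simp add: sum_distrib_left[symmetric] sum.distrib)
  also have "(\<Sum>i=1..<N. real (N - i) powr (- p)) = (\<Sum>i=1..<N. real i powr (- p))"
    by (rule sum.reindex_bij_witness[of _ "\<lambda>i. N - i" "\<lambda>i. N - i"]) auto
  also have "(real N / 2) powr (- min p q) *
      ((\<Sum>i=1..<N. real i powr (- p)) + (\<Sum>i=1..<N. real i powr (- p)))
      \<le> (real N / 2) powr (- min p q) * (Z + Z)"
    using Z by (intro mult_left_mono add_mono) auto
  finally show ?thesis by (simp add: Z_def mult_ac)
qed

lemma powr_kernel_increment:
  fixes \<alpha> a b s t :: real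
  assumes "0 < \<alpha>" "a < s" "s < b" "b < t"
  shows "0 < (t - s) powr (- \<alpha>) - (t - a) powr (- \<alpha>)"
    and "(t - s) powr (- \<alpha>) - (t - a) powr (- \<alpha>) \<le> \<alpha> * (b - a) * (t - b) powr (- \<alpha> - 1)"
proof -
  show "0 < (t - s) powr (- \<alpha>) - (t - a) powr (- \<alpha>)"
    using assms powr_less_mono2_neg[of "- \<alpha>" "t - s" "t - a"] by simp
  have "\<exists>z. t - s < z \<and> z < t - a \<and>
      (t - a) powr (- \<alpha>) - (t - s) powr (- \<alpha>) = (t - a - (t - s)) * (- \<alpha> * z powr (- \<alpha> - 1))"
    using assms by (intro MVT2 has_real_derivative_powr) auto
  then obtain z where z: "t - s < z"
    and eq: "(t - a) powr (- \<alpha>) - (t - s) powr (- \<alpha>) = (s - a) * (- \<alpha> * z powr (- \<alpha> - 1))"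
    by auto
  have "(t - s) powr (- \<alpha>) - (t - a) powr (- \<alpha>) = \<alpha> * (s - a) * z powr (- \<alpha> - 1)"
    using eq by (simp add: algebra_simps)
  also have "\<dots> \<le> \<alpha> * (b - a) * (t - b) powr (- \<alpha> - 1)"
    using assms z by (intro mult_mono powr_mono2') auto
  finally show "(t - s) powr (- \<alpha>) - (t - a) powr (- \<alpha>) \<le> \<alpha> * (b - a) * (t - b) powr (- \<alpha> - 1)" .
qed

section \<open>Paths with a weak singularity at time zero\<close>

text \<open>A path of functions on a measure space. The assumptions on \<open>v\<close> in time are pointwise in space;
those on its size are for each time separately and have the form of the regularity assumption on
the solution. The size of \<open>v\<close> itself is left open, since only increments of \<open>v\<close> enter the residual.\<close>

locale L2_singular_path =
  fixes M :: "'a measure" and v :: "'a \<Rightarrow> real \<Rightarrow> real" and C \<sigma> T :: real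
  assumes sigma_finite: "sigma_finite_measure M"
    and T_pos: "0 < T" and \<sigma>_pos: "0 < \<sigma>" and \<sigma>_le: "\<sigma> \<le> 2"
    and cont: "\<And>x. x \<in> space M \<Longrightarrow> continuous_on {0..T} (v x)"
    and diff1: "\<And>x t. x \<in> space M \<Longrightarrow> t \<in> {0<..<T} \<Longrightarrow> v x differentiable (at t)"
    and diff2: "\<And>x t. x \<in> space M \<Longrightarrow> t \<in> {0<..<T} \<Longrightarrow> deriv (v x) differentiable (at t)"
    and bound1: "\<And>t. t \<in> {0<..<T} \<Longrightarrow>
      L2_bound M (\<lambda>x. deriv (v x) t) (C * t powr (\<sigma> - 1))"
    and bound2: "\<And>t. t \<in> {0<..<T} \<Longrightarrow>
      L2_bound M (\<lambda>x. deriv (deriv (v x)) t) (C * t powr (\<sigma> - 2))"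
begin

text \<open>The time derivatives are extended by zero outside the open interval, so that they can be treated as
measurable functions on the whole real line.\<close>

definition v1 :: "'a \<Rightarrow> real \<Rightarrow> real" where
  "v1 x s = (if s \<in> {0<..<T} then deriv (v x) s else 0)"

definition v2 :: "'a \<Rightarrow> real \<Rightarrow> real" where
  "v2 x s = (if s \<in> {0<..<T} then deriv (deriv (v x)) s else 0)"

lemma C_pos: "0 < C"
  using L2_boundD(1)[OF bound1[of "T / 2"]] T_pos by (simp add: zero_less_mult_iff)

lemma L2_bound_v1: "s \<in> {0<..<T} \<Longrightarrow> L2_bound M (\<lambda>x. v1 x s) (C * s powr (\<sigma> - 1))"
  using bound1 by (simp add: v1_def)

lemma L2_bound_v2: "s \<in> {0<..<T} \<Longrightarrow> L2_bound M (\<lambda>x. v2 x s) (C * s powr (\<sigma> - 2))"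
  using bound2 by (simp add: v2_def)

lemma v_has_derivative:
  "x \<in> space M \<Longrightarrow> s \<in> {0<..<T} \<Longrightarrow> (v x has_real_derivative v1 x s) (at s)"
  using diff1[of x s] by (simp add: v1_def DERIV_deriv_iff_real_differentiable)

lemma v1_has_derivative:
  assumes "x \<in> space M" "s \<in> {0<..<T}"
  shows "(v1 x has_real_derivative v2 x s) (at s)"
proof -
  have "(deriv (v x) has_real_derivative v2 x s) (at s)"
    using diff2[OF assms] assms by (simp add: v2_def DERIV_deriv_iff_real_differentiable)
  then show ?thesis
    by (rule has_field_derivative_transform_within_open[of _ _ _ "{0<..<T}"])
       (use assms in \<open>auto simp: v1_def\<close>)
qed

lemma v1_measurable_at [measurable]: "(\<lambda>x. v1 x s) \<in> borel_measurable M"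
  using L2_boundD(2)[OF L2_bound_v1[of s]] by (cases "s \<in> {0<..<T}") (auto simp: v1_def)

lemma v1_measurable [measurable]: "(\<lambda>(x, s). v1 x s) \<in> borel_measurable (M \<Otimes>\<^sub>M lborel)"
proof (rule borel_measurable_pair_right_continuous[where A = "{0<..<T}"])
  show "continuous (at_right s) (v1 x)" if "x \<in> space M" "s \<in> {0<..<T}" for x s
    using DERIV_isCont[OF v1_has_derivative[OF that]]
    by (rule continuous_at_imp_continuous_at_within)
  show "v1 x s = 0" if "s \<notin> {0<..<T}" for x s
    using that by (auto simp: v1_def)
qed auto

lemma v2_measurable [measurable]: "(\<lambda>(x, s). v2 x s) \<in> borel_measurable (M \<Otimes>\<^sub>M lborel)"
proof (rule borel_measurable_LIMSEQ_real)
  define h where "h k = 1 / real (Suc k)" for k :: nat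
  define Q where "Q k p = indicat_real {0<..<T} (snd p) *
      ((v1 (fst p) (snd p + h k) - v1 (fst p) (snd p)) / h k)" for k and p :: "'a \<times> real"
  have h: "filterlim h (at 0) sequentially"
    using LIMSEQ_inverse_real_of_nat
    by (auto simp: filterlim_at h_def[abs_def] inverse_eq_divide)
  show "(\<lambda>k. Q k p) \<longlonglongrightarrow> (case p of (x, s) \<Rightarrow> v2 x s)" if "p \<in> space (M \<Otimes>\<^sub>M lborel)" for p
  proof -
    obtain x s where p: "p = (x, s)" by (cases p)
    with that have x: "x \<in> space M" by (simp add: space_pair_measure)
    show ?thesis
    proof (cases "s \<in> {0<..<T}")
      case True
      then have "((\<lambda>e. (v1 x (s + e) - v1 x s) / e) \<longlongrightarrow> v2 x s) (at 0)"
        using v1_has_derivative[OF x True] by (simp add: DERIV_def)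
      from filterlim_compose[OF this h] True show ?thesis by (simp add: p Q_def)
    qed (auto simp: p Q_def v2_def)
  qed
  show "Q k \<in> borel_measurable (M \<Otimes>\<^sub>M lborel)" for k
  proof -
    have "(\<lambda>p. v1 (fst p) (snd p + h k)) \<in> borel_measurable (M \<Otimes>\<^sub>M lborel)"
      using measurable_compose[OF _ v1_measurable, of "\<lambda>p. (fst p, snd p + h k)" "M \<Otimes>\<^sub>M lborel"]
      by simp
    then show ?thesis unfolding Q_def by measurable
  qed
qed

text \<open>The mean value inequality in \<open>L\<^sup>2\<close>, valid because \<open>C * r powr (\<sigma> - 2)\<close> is largest at the left end
of the interval.\<close>

lemma L2_bound_v1_diff:
  assumes "0 < a" "b \<le> T" "s \<in> {a<..<b}" "y \<in> {a<..<b}"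
  shows "L2_bound M (\<lambda>x. v1 x y - v1 x s) (C * (b - a) * a powr (\<sigma> - 2))"
proof -
  have pos: "0 < C * (b - a) * a powr (\<sigma> - 2)" using assms C_pos by auto
  have ordered: "L2_bound M (\<lambda>x. v1 x y - v1 x s) (C * (b - a) * a powr (\<sigma> - 2))"
    if "s \<in> {a<..<b}" "y \<in> {a<..<b}" "s < y" for s y
  proof -
    define K where "K = C * a powr (\<sigma> - 2)"
    have K: "0 < K" using C_pos assms by (simp add: K_def)
    have w: "set_integrable lborel {s<..<y} (\<lambda>_. K)"
      by (rule set_integral_Ioo_const)
    have I: "(LBINT r:{s<..<y}. K) = (y - s) * K"
      using that by (simp add: set_integral_Ioo_const)
    have bd: "L2_bound M (\<lambda>x. v2 x r) K" if r: "r \<in> {s<..<y}" for r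
    proof (rule L2_bound_mono[OF L2_bound_v2])
      show "r \<in> {0<..<T}" using r that assms \<open>s \<in> _\<close> \<open>y \<in> _\<close> by auto
      show "C * r powr (\<sigma> - 2) \<le> K"
        unfolding K_def using r C_pos \<sigma>_le \<open>s \<in> _\<close> assms
        by (intro mult_left_mono powr_mono2') auto
    qed
    note mink = L2_bound_set_integral[OF sigma_finite lborel.sigma_finite_measure_axioms
        v2_measurable _ bd w I]
    have "AE x in M. (LBINT r:{s<..<y}. v2 x r) = v1 x y - v1 x s"
    proof (rule AE_mp[OF mink(1)])
      show "AE x in M. set_integrable lborel {s<..<y} (v2 x) \<longrightarrow>
          (LBINT r:{s<..<y}. v2 x r) = v1 x y - v1 x s"
      proof (intro AE_I2 impI)
        fix x assume x: "x \<in> space M" and int: "set_integrable lborel {s<..<y} (v2 x)"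
        have der: "(v1 x has_real_derivative v2 x r) (at r)" if "r \<in> {s..y}" for r
          using that x \<open>s \<in> _\<close> \<open>y \<in> _\<close> assms by (intro v1_has_derivative) auto
        show "(LBINT r:{s<..<y}. v2 x r) = v1 x y - v1 x s"
        proof (rule set_integral_FTC[OF _ _ _ int])
          show "continuous_on {s..y} (v1 x)"
            using der DERIV_isCont by (intro continuous_at_imp_continuous_on) blast
        qed (use der that in auto)
      qed
    qed (use that K in auto)
    then have "L2_bound M (\<lambda>x. v1 x y - v1 x s) ((y - s) * K)"
      using that K by (intro L2_bound_cong_AE[OF mink(2)]) auto
    moreover have "(y - s) * K \<le> C * (b - a) * a powr (\<sigma> - 2)"
    proof -
      have "(y - s) * K \<le> (b - a) * K"
        using that K by (intro mult_right_mono) auto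
      then show ?thesis by (simp add: K_def mult_ac)
    qed
    ultimately show ?thesis by (rule L2_bound_mono)
  qed
  consider "s < y" | "y < s" | "s = y" by linarith
  then show ?thesis
  proof cases
    case 2
    then show ?thesis
      using L2_bound_cmult[OF ordered[of y s], of "- 1"] assms by simp
  next
    case 3
    then show ?thesis using pos by (simp add: L2_bound_def)
  qed (use ordered assms in auto)
qed

text \<open>Inside the open interval an increment is the integral of the continuous function \<open>v1 x\<close> for every
\<open>x\<close>, which is measurable in \<open>x\<close>. The endpoints \<open>0\<close> and \<open>T\<close> are reached by continuity of \<open>v x\<close>.\<close>

lemma v_increment_measurable [measurable]:
  assumes ab: "0 \<le> a" "a \<le> b" "b \<le> T"
  shows "(\<lambda>x. v x b - v x a) \<in> borel_measurable M"
proof (cases "a = b")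
  case False
  have inner: "(\<lambda>x. v x y - v x s) \<in> borel_measurable M" if sy: "0 < s" "s \<le> y" "y < T" for s y
  proof -
    have eq: "(LBINT r:{s<..<y}. v1 x r) = v x y - v x s" if x: "x \<in> space M" for x
    proof (rule set_integral_FTC)
      have "continuous_on {s..y} (v1 x)"
        using DERIV_isCont[OF v1_has_derivative[OF x]] sy
        by (intro continuous_at_imp_continuous_on) auto
      then have "set_integrable lborel {s..y} (v1 x)"
        by (rule borel_integrable_atLeastAtMost')
      then show "set_integrable lborel {s<..<y} (v1 x)"
        by (rule set_integrable_subset) auto
      show "continuous_on {s..y} (v x)"
        by (rule continuous_on_subset[OF cont[OF x]]) (use sy in auto)
    qed (use sy x in \<open>auto intro: v_has_derivative\<close>)
    have "(\<lambda>x. LBINT r:{s<..<y}. v1 x r) \<in> borel_measurable M"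
      unfolding set_lebesgue_integral_def by measurable
    then show ?thesis using eq by (simp cong: measurable_cong)
  qed
  define e where "e k = (b - a) / real (k + 2)" for k :: nat
  have e: "0 < e k" "2 * e k \<le> b - a" for k
  proof -
    show "0 < e k" using False ab by (simp add: e_def)
    have "e k \<le> (b - a) / 2"
      unfolding e_def using ab by (intro divide_left_mono) auto
    then show "2 * e k \<le> b - a" by simp
  qed
  have e0: "e \<longlonglongrightarrow> 0" unfolding e_def by (rule LIMSEQ_ignore_initial_segment[OF lim_const_over_n])
  show ?thesis
  proof (rule borel_measurable_LIMSEQ_real)
    show "(\<lambda>x. v x (b - e k) - v x (a + e k)) \<in> borel_measurable M" for k
      using e[of k] ab by (intro inner) auto
    show "(\<lambda>k. v x (b - e k) - v x (a + e k)) \<longlonglongrightarrow> v x b - v x a" if x: "x \<in> space M" for x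
    proof (rule tendsto_diff)
      show "(\<lambda>k. v x (b - e k)) \<longlonglongrightarrow> v x b"
      proof (rule continuous_on_tendsto_compose[OF cont[OF x]])
        show "(\<lambda>k. b - e k) \<longlonglongrightarrow> b" using tendsto_diff[OF tendsto_const e0, of b] by simp
        show "\<forall>\<^sub>F k in sequentially. b - e k \<in> {0..T}"
          using e ab by (intro always_eventually allI) (smt (verit) atLeastAtMost_iff)
      qed (use ab in auto)
      show "(\<lambda>k. v x (a + e k)) \<longlonglongrightarrow> v x a"
      proof (rule continuous_on_tendsto_compose[OF cont[OF x]])
        show "(\<lambda>k. a + e k) \<longlonglongrightarrow> a" using tendsto_add[OF tendsto_const e0, of a] by simp
        show "\<forall>\<^sub>F k in sequentially. a + e k \<in> {0..T}"
          using e ab by (intro always_eventually allI) (smt (verit) atLeastAtMost_iff)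
      qed (use ab in auto)
    qed
  qed
qed simp

lemma v_increment_integral:
  assumes ab: "0 \<le> a" "a < b" "b \<le> T"
  shows "AE x in M. set_integrable lborel {a<..<b} (v1 x) \<and>
           (LBINT s:{a<..<b}. v1 x s) = v x b - v x a"
proof -
  have w: "set_integrable lborel {0<..<T} (\<lambda>s. C * s powr (\<sigma> - 1))"
    using power_singularity_integral(1)[OF \<sigma>_pos] T_pos by simp
  have I: "(LBINT s:{0<..<T}. C * s powr (\<sigma> - 1)) = C * (T powr \<sigma> / \<sigma>)"
    using power_singularity_integral(2)[OF \<sigma>_pos] T_pos by simp
  have "AE x in M. set_integrable lborel {0<..<T} (v1 x)"
    by (rule L2_bound_set_integral(1)[OF sigma_finite lborel.sigma_finite_measure_axioms
          v1_measurable _ L2_bound_v1 w I])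
       (use C_pos T_pos \<sigma>_pos in simp_all)
  then show ?thesis
  proof (rule AE_mp, intro AE_I2 impI)
    fix x assume x: "x \<in> space M" and "set_integrable lborel {0<..<T} (v1 x)"
    then have int: "set_integrable lborel {a<..<b} (v1 x)"
      using ab by (auto intro: set_integrable_subset)
    moreover have "(LBINT s:{a<..<b}. v1 x s) = v x b - v x a"
    proof (rule set_integral_FTC[OF _ _ _ int])
      show "continuous_on {a..b} (v x)"
        by (rule continuous_on_subset[OF cont[OF x]]) (use ab in auto)
    qed (use ab x in \<open>auto intro: v_has_derivative\<close>)
    ultimately show "set_integrable lborel {a<..<b} (v1 x) \<and>
           (LBINT s:{a<..<b}. v1 x s) = v x b - v x a" by simp
  qed
qed

text \<open>The slope is the mean of \<open>v1\<close> over the interval, so its deviation from \<open>v1 x s\<close> is the mean of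
the differences \<open>v1 x y - v1 x s\<close>.\<close>

lemma L2_bound_slope_deviation:
  assumes ab: "0 < a" "a < b" "b \<le> T" and s: "s \<in> {a<..<b}"
  shows "L2_bound M (\<lambda>x. (v x b - v x a) / (b - a) - v1 x s) (C * (b - a) * a powr (\<sigma> - 2))"
    (is "L2_bound M _ ?K")
proof -
  have K: "0 < ?K" using ab C_pos by simp
  have w: "set_integrable lborel {a<..<b} (\<lambda>_. ?K)"
    by (rule set_integral_Ioo_const)
  have I: "(LBINT r:{a<..<b}. ?K) = (b - a) * ?K"
    using ab by (simp add: set_integral_Ioo_const)
  have [measurable]: "(\<lambda>p. v1 (fst p) s) \<in> borel_measurable (M \<Otimes>\<^sub>M lborel)"
    by (rule measurable_compose[OF measurable_fst v1_measurable_at])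
  have meas: "(\<lambda>(x, y). v1 x y - v1 x s) \<in> borel_measurable (M \<Otimes>\<^sub>M lborel)"
    using v1_measurable by (simp add: case_prod_beta)
  have mink: "L2_bound M (\<lambda>x. LBINT y:{a<..<b}. v1 x y - v1 x s) ((b - a) * ?K)"
    using L2_bound_set_integral(2)[OF sigma_finite lborel.sigma_finite_measure_axioms
        meas _ L2_bound_v1_diff[OF ab(1,3) s] w I] ab K
    by simp
  have "AE x in M. (LBINT y:{a<..<b}. v1 x y - v1 x s) = v x b - v x a - (b - a) * v1 x s"
    using v_increment_integral[of a b]
  proof (rule AE_mp[OF _ AE_I2])
    fix x
    show "set_integrable lborel {a<..<b} (v1 x) \<and> (LBINT s:{a<..<b}. v1 x s) = v x b - v x a \<longrightarrow>
      (LBINT y:{a<..<b}. v1 x y - v1 x s) = v x b - v x a - (b - a) * v1 x s"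
    proof (intro impI, elim conjE)
      assume int: "set_integrable lborel {a<..<b} (v1 x)"
        and eq: "(LBINT s:{a<..<b}. v1 x s) = v x b - v x a"
      have const: "set_integrable lborel {a<..<b} (\<lambda>_. v1 x s)"
        by (rule set_integral_Ioo_const)
      have "(LBINT y:{a<..<b}. v1 x s) = (b - a) * v1 x s"
        using ab by (simp add: set_integral_Ioo_const)
      then show "(LBINT y:{a<..<b}. v1 x y - v1 x s) = v x b - v x a - (b - a) * v1 x s"
        using set_integral_diff(2)[OF int const] eq by simp
    qed
  qed (use ab in auto)
  then have "L2_bound M (\<lambda>x. v x b - v x a - (b - a) * v1 x s) ((b - a) * ?K)"
    using ab by (intro L2_bound_cong_AE[OF mink]) auto
  from L2_bound_cmult[OF this, of "1 / (b - a)"] ab show ?thesis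
    by (simp add: diff_divide_distrib)
qed

text \<open>On an interval that starts at zero the bound for the second derivative is useless for \<open>\<sigma> < 1\<close>, as
it is not integrable there. The slope and the derivative are therefore bounded separately.\<close>

lemma L2_bound_slope_deviation_first:
  assumes b: "0 < b" "b \<le> T" and s: "s \<in> {0<..<b}"
  shows "L2_bound M (\<lambda>x. (v x b - v x 0) / b - v1 x s)
           (C * b powr (\<sigma> - 1) / \<sigma> + C * s powr (\<sigma> - 1))"
proof -
  have w: "set_integrable lborel {0<..<b} (\<lambda>s. C * s powr (\<sigma> - 1))"
    using power_singularity_integral(1)[OF \<sigma>_pos] b by simp
  have I: "(LBINT s:{0<..<b}. C * s powr (\<sigma> - 1)) = C * (b powr \<sigma> / \<sigma>)"
    using power_singularity_integral(2)[OF \<sigma>_pos] b by simp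
  have bd: "L2_bound M (\<lambda>x. v1 x r) (C * r powr (\<sigma> - 1))" if "r \<in> {0<..<b}" for r
    using that b by (intro L2_bound_v1) auto
  have mink: "L2_bound M (\<lambda>x. LBINT s:{0<..<b}. v1 x s) (C * (b powr \<sigma> / \<sigma>))"
    using L2_bound_set_integral(2)[OF sigma_finite lborel.sigma_finite_measure_axioms
        v1_measurable _ bd w I] C_pos b \<sigma>_pos by simp
  have "L2_bound M (\<lambda>x. v x b - v x 0) (C * (b powr \<sigma> / \<sigma>))"
    using v_increment_integral[of 0 b] b by (intro L2_bound_cong_AE[OF mink]) auto
  from L2_bound_cmult[OF this, of "1 / b"]
  have "L2_bound M (\<lambda>x. (v x b - v x 0) / b) (C * b powr (\<sigma> - 1) / \<sigma>)"
    using b by (simp add: powr_diff)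
  from L2_bound_add[OF this L2_bound_cmult[OF bd[OF s], of "- 1"]] show ?thesis by simp
qed

lemma L2_bound_kernel_term:
  assumes ab: "0 \<le> a" "a < b" "b \<le> T"
    and dev: "\<And>s. s \<in> {a<..<b} \<Longrightarrow> L2_bound M (\<lambda>x. (v x b - v x a) / (b - a) - v1 x s) (\<rho> s)"
    and \<kappa>: "\<And>s. s \<in> {a<..<b} \<Longrightarrow> 0 < \<kappa> s" "\<kappa> \<in> borel_measurable borel"
    and w: "\<And>s. s \<in> {a<..<b} \<Longrightarrow> \<kappa> s * \<rho> s \<le> w s"
    and int: "set_integrable lborel {a<..<b} w" and W: "(LBINT s:{a<..<b}. w s) = W" "0 < W"
  shows "L2_bound M (\<lambda>x. LBINT s:{a<..<b}. ((v x b - v x a) / (b - a) - v1 x s) * \<kappa> s) W"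
proof -
  note [measurable] = \<kappa>(2)
  have [measurable]: "(\<lambda>p. v (fst p) b - v (fst p) a) \<in> borel_measurable (M \<Otimes>\<^sub>M lborel)"
    by (rule measurable_compose[OF measurable_fst v_increment_measurable]) (use ab in auto)
  have meas: "(\<lambda>(x, s). ((v x b - v x a) / (b - a) - v1 x s) * \<kappa> s) \<in> borel_measurable (M \<Otimes>\<^sub>M lborel)"
    using v1_measurable by (simp add: case_prod_beta)
  have bd: "L2_bound M (\<lambda>x. ((v x b - v x a) / (b - a) - v1 x s) * \<kappa> s) (w s)"
    if s: "s \<in> {a<..<b}" for s
    using L2_bound_cmult[OF dev[OF s], of "\<kappa> s"] \<kappa>(1)[OF s] w[OF s]
    by (simp add: mult.commute) (rule L2_bound_mono, auto simp: mult.commute)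
  show ?thesis
    using L2_bound_set_integral(2)[OF sigma_finite lborel.sigma_finite_measure_axioms meas _ bd int W]
    by simp
qed

section \<open>Splitting the residual over the grid intervals\<close>

text \<open>The contribution of the grid interval number \<open>j\<close> to the residual at step \<open>n\<close>. The constant that is
subtracted from the kernel does not change the integral, because the other factor has mean zero.
The last interval keeps the full kernel: its singularity lies at the right end, where its increment
is as large as the kernel itself.\<close>

definition local_error :: "real \<Rightarrow> real \<Rightarrow> nat \<Rightarrow> nat \<Rightarrow> 'a \<Rightarrow> real" where
  "local_error \<alpha> \<tau> n j x =
     (LBINT s:{real (j - 1) * \<tau><..<real j * \<tau>}.
        ((v x (real j * \<tau>) - v x (real (j - 1) * \<tau>)) / \<tau> - v1 x s) *
        ((real n * \<tau> - s) powr (- \<alpha>) -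
         (if j < n then (real n * \<tau> - real (j - 1) * \<tau>) powr (- \<alpha>) else 0)))"

lemma grid_point_le: "j \<le> n \<Longrightarrow> real n * \<tau> \<le> T \<Longrightarrow> 0 < \<tau> \<Longrightarrow> real j * \<tau> \<le> T"
  by (erule order_trans[rotated]) (simp add: mult_right_mono)

lemma caputo_eq:
  assumes "t \<le> T"
  shows "caputo_deriv \<alpha> (v x) t =
           1 / Gamma (1 - \<alpha>) * (LBINT s:{0<..<t}. v1 x s * (t - s) powr (- \<alpha>))"
proof -
  have "(LBINT s:{0<..<t}. deriv (v x) s / (t - s) powr \<alpha>)
      = (LBINT s:{0<..<t}. v1 x s * (t - s) powr (- \<alpha>))"
    using assms by (intro set_lebesgue_integral_cong) (auto simp: v1_def powr_minus divide_inverse)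
  then show ?thesis by (simp add: caputo_deriv_def)
qed

lemma v1_kernel_measurable:
  "(\<lambda>(x, s). v1 x s * (t - s) powr (- \<alpha>)) \<in> borel_measurable (M \<Otimes>\<^sub>M lborel)"
  using v1_measurable by (simp add: case_prod_beta)

lemma L1_residual_measurable:
  assumes "0 < \<tau>" and n: "real n * \<tau> \<le> T"
  shows "L1_residual \<alpha> \<tau> v n \<in> borel_measurable M"
proof -
  have "(\<lambda>x. L1_operator \<alpha> \<tau> (\<lambda>j. v x (real j * \<tau>)) n) \<in> borel_measurable M"
    unfolding L1_operator_def
  proof (intro borel_measurable_times borel_measurable_sum borel_measurable_const)
    fix j assume "j \<in> {1..n}"
    then show "(\<lambda>x. v x (real j * \<tau>) - v x (real (j - 1) * \<tau>)) \<in> borel_measurable M"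
      using assms grid_point_le[of j n \<tau>] by (intro v_increment_measurable) auto
  qed
  moreover have "(\<lambda>x. caputo_deriv \<alpha> (v x) (real n * \<tau>)) \<in> borel_measurable M"
    using v1_kernel_measurable[of "real n * \<tau>" \<alpha>]
    unfolding caputo_eq[OF n] set_lebesgue_integral_def by measurable
  ultimately show ?thesis unfolding L1_residual_def[abs_def] by measurable
qed

text \<open>Almost everywhere in space the integral in the Caputo derivative converges.\<close>

lemma v1_kernel_integrable:
  assumes \<alpha>: "0 < \<alpha>" "\<alpha> < 1" and t: "0 < t" "t \<le> T"
  shows "AE x in M. set_integrable lborel {0<..<t} (\<lambda>s. v1 x s * (t - s) powr (- \<alpha>))"
proof -
  define w where "w s = C * (t / 2) powr (- \<alpha>) * s powr (\<sigma> - 1)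
      + 2 * C * t powr (\<sigma> - 1) * (t - s) powr (- \<alpha>)" for s
  note int1 = power_singularity_integral[OF \<sigma>_pos, of t]
  note int2 = abel_kernel_integral[OF \<open>\<alpha> < 1\<close>, of 0 t t]
  have w1: "set_integrable lborel {0<..<t} w"
    unfolding w_def using int1(1) int2(1) t by (intro set_integral_add(1)) auto
  have w2: "(LBINT s:{0<..<t}. w s) = C * (t / 2) powr (- \<alpha>) * (t powr \<sigma> / \<sigma>)
      + 2 * C * t powr (\<sigma> - 1) * (t powr (1 - \<alpha>) / (1 - \<alpha>))"
    unfolding w_def using int1 int2 t by (subst set_integral_add(2)) auto
  have bd: "L2_bound M (\<lambda>x. v1 x s * (t - s) powr (- \<alpha>)) (w s)" if s: "s \<in> {0<..<t}" for s
  proof (rule L2_bound_mono)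
    show "L2_bound M (\<lambda>x. v1 x s * (t - s) powr (- \<alpha>)) ((t - s) powr (- \<alpha>) * (C * s powr (\<sigma> - 1)))"
      using L2_bound_cmult[OF L2_bound_v1[of s], of "(t - s) powr (- \<alpha>)"] s t
      by (simp add: mult.commute)
    show "(t - s) powr (- \<alpha>) * (C * s powr (\<sigma> - 1)) \<le> w s"
      using mult_left_mono[OF beta_integrand_bound[of \<alpha> \<sigma> s t], of C] \<alpha> \<sigma>_pos s C_pos
      by (simp add: w_def algebra_simps)
  qed
  show ?thesis
    by (rule L2_bound_set_integral(1)[OF sigma_finite lborel.sigma_finite_measure_axioms
          v1_kernel_measurable _ bd w1 w2])
       (use C_pos \<sigma>_pos t \<alpha> in \<open>auto intro!: add_pos_pos mult_pos_pos divide_pos_pos\<close>)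
qed

lemma L1_residual_eq_local_errors:
  assumes \<alpha>: "0 < \<alpha>" "\<alpha> < 1" and \<tau>: "0 < \<tau>" and n: "1 \<le> n" "real n * \<tau> \<le> T"
  shows "AE x in M. L1_residual \<alpha> \<tau> v n x =
           1 / Gamma (1 - \<alpha>) * (\<Sum>j=1..n. local_error \<alpha> \<tau> n j x)"
proof -
  define t where "t = real n * \<tau>"
  have t: "0 < t" "t \<le> T" using \<tau> n by (auto simp: t_def)
  have incr: "AE x in M. \<forall>j\<in>{1..n}. set_integrable lborel {real (j - 1) * \<tau><..<real j * \<tau>} (v1 x) \<and>
      (LBINT s:{real (j - 1) * \<tau><..<real j * \<tau>}. v1 x s) = v x (real j * \<tau>) - v x (real (j - 1) * \<tau>)"
    by (intro AE_finite_allI v_increment_integral) (use \<tau> n grid_point_le in auto)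
  show ?thesis
    using v1_kernel_integrable[OF \<alpha> t] incr
  proof eventually_elim
    case (elim x)
    have jump: "1 / Gamma (1 - \<alpha>) * local_error \<alpha> \<tau> n j x =
        \<tau> powr (- \<alpha>) / Gamma (2 - \<alpha>) *
          (L1_weight \<alpha> (n - j) * (v x (real j * \<tau>) - v x (real (j - 1) * \<tau>)))
        - 1 / Gamma (1 - \<alpha>) *
          (LBINT s:{real (j - 1) * \<tau><..<real j * \<tau>}. v1 x s * (t - s) powr (- \<alpha>))"
      if j: "j \<in> {1..n}" for j
    proof -
      define a b where "a = real (j - 1) * \<tau>" and "b = real j * \<tau>"
      have ab: "0 \<le> a" "a < b" "b \<le> t" "b - a = \<tau>"
        using j \<tau> by (auto simp: a_def b_def t_def of_nat_diff algebra_simps)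
      define D where "D = (v x b - v x a) / \<tau>"
      define c where "c = (if j < n then (t - a) powr (- \<alpha>) else 0)"
      have int_v1: "set_integrable lborel {a<..<b} (v1 x)"
        and eq_v1: "(LBINT s:{a<..<b}. v1 x s) = D * \<tau>"
        using elim(2) j \<tau> by (auto simp: a_def b_def D_def)
      have int_v1k: "set_integrable lborel {a<..<b} (\<lambda>s. v1 x s * (t - s) powr (- \<alpha>))"
        by (rule set_integrable_subset[OF elim(1)]) (use ab in auto)
      note int_k = abel_kernel_integral[OF \<open>\<alpha> < 1\<close> less_imp_le[OF ab(2)] ab(3)]
      have k: "(LBINT s:{a<..<b}. (t - s) powr (- \<alpha>))
          = \<tau> powr (1 - \<alpha>) * L1_weight \<alpha> (n - j) / (1 - \<alpha>)"
      proof -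
        have ta: "t - a = (real (n - j) + 1) * \<tau>"
          and tb: "t - b = real (n - j) * \<tau>"
          using j by (auto simp: t_def a_def b_def of_nat_diff algebra_simps)
        show ?thesis
          unfolding int_k(2) ta tb
          using \<tau> by (simp add: L1_weight_def powr_mult right_diff_distrib mult.commute)
      qed
      have int1: "set_integrable lborel {a<..<b} (\<lambda>s. D * (t - s) powr (- \<alpha>) - D * c)"
        using int_k(1) by (intro set_integral_diff(1) set_integral_Ioo_const) auto
      have int2: "set_integrable lborel {a<..<b} (\<lambda>s. v1 x s * (t - s) powr (- \<alpha>) - c * v1 x s)"
        using int_v1 int_v1k by (intro set_integral_diff(1)) auto
      have "local_error \<alpha> \<tau> n j x = (LBINT s:{a<..<b}. (D - v1 x s) * ((t - s) powr (- \<alpha>) - c))"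
        by (simp add: local_error_def a_def b_def t_def c_def D_def)
      also have "\<dots> = (LBINT s:{a<..<b}. (D * (t - s) powr (- \<alpha>) - D * c) -
          (v1 x s * (t - s) powr (- \<alpha>) - c * v1 x s))"
        by (simp add: algebra_simps)
      also have "\<dots> = (LBINT s:{a<..<b}. D * (t - s) powr (- \<alpha>) - D * c) -
          (LBINT s:{a<..<b}. v1 x s * (t - s) powr (- \<alpha>) - c * v1 x s)"
        by (rule set_integral_diff(2)[OF int1 int2])
      also have "(LBINT s:{a<..<b}. D * (t - s) powr (- \<alpha>) - D * c)
          = D * (LBINT s:{a<..<b}. (t - s) powr (- \<alpha>)) - \<tau> * (D * c)"
        using int_k(1) ab
        by (subst set_integral_diff(2)) (auto simp: set_integral_Ioo_const simp del: set_integral_mult_right set_integral_mult_left, simp_all)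
      also have "(LBINT s:{a<..<b}. v1 x s * (t - s) powr (- \<alpha>) - c * v1 x s)
          = (LBINT s:{a<..<b}. v1 x s * (t - s) powr (- \<alpha>)) - c * (D * \<tau>)"
        using int_v1 int_v1k by (subst set_integral_diff(2)) (auto simp: eq_v1)
      finally have E: "local_error \<alpha> \<tau> n j x =
          D * (\<tau> powr (1 - \<alpha>) * L1_weight \<alpha> (n - j) / (1 - \<alpha>))
          - (LBINT s:{a<..<b}. v1 x s * (t - s) powr (- \<alpha>))"
        by (simp add: k algebra_simps)
      have "1 - \<alpha> \<notin> \<int>\<^sub>\<le>\<^sub>0"
      proof
        assume "1 - \<alpha> \<in> \<int>\<^sub>\<le>\<^sub>0"
        then have "1 - \<alpha> \<le> 0" by (rule nonpos_Ints_nonpos)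
        then show False using \<alpha> by simp
      qed
      then have G2: "Gamma (2 - \<alpha>) = (1 - \<alpha>) * Gamma (1 - \<alpha>)"
        using Gamma_plus1[of "1 - \<alpha>"] by simp
      have "D * \<tau> powr (1 - \<alpha>) = \<tau> powr (- \<alpha>) * (v x b - v x a)"
        using \<tau> by (simp add: D_def powr_diff powr_minus field_simps)
      then have "\<tau> powr (- \<alpha>) / Gamma (2 - \<alpha>) * (L1_weight \<alpha> (n - j) * (v x b - v x a))
          = D * \<tau> powr (1 - \<alpha>) * L1_weight \<alpha> (n - j) / Gamma (2 - \<alpha>)"
        by simp
      also have "\<dots> = 1 / Gamma (1 - \<alpha>) * (D * (\<tau> powr (1 - \<alpha>) * L1_weight \<alpha> (n - j) / (1 - \<alpha>)))"
        unfolding G2 by (simp add: mult_ac)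
      finally have "1 / Gamma (1 - \<alpha>) * (D * (\<tau> powr (1 - \<alpha>) * L1_weight \<alpha> (n - j) / (1 - \<alpha>)))
          = \<tau> powr (- \<alpha>) / Gamma (2 - \<alpha>) * (L1_weight \<alpha> (n - j) * (v x b - v x a))"
        by (rule sym)
      then show ?thesis
        unfolding E right_diff_distrib by (simp add: a_def b_def)
    qed
    have "1 / Gamma (1 - \<alpha>) * (\<Sum>j=1..n. local_error \<alpha> \<tau> n j x)
        = L1_operator \<alpha> \<tau> (\<lambda>j. v x (real j * \<tau>)) n
          - 1 / Gamma (1 - \<alpha>) * (\<Sum>j=1..n.
              LBINT s:{real (j - 1) * \<tau><..<real j * \<tau>}. v1 x s * (t - s) powr (- \<alpha>))"
      unfolding sum_distrib_left L1_operator_def sum_subtractf[symmetric]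
      by (rule sum.cong[OF refl jump])
    also have "(\<Sum>j=1..n. LBINT s:{real (j - 1) * \<tau><..<real j * \<tau>}. v1 x s * (t - s) powr (- \<alpha>))
        = (LBINT s:{0<..<t}. v1 x s * (t - s) powr (- \<alpha>))"
      using set_integral_grid[of \<tau> n] elim(1) \<tau> by (simp add: t_def)
    also have "1 / Gamma (1 - \<alpha>) * \<dots> = caputo_deriv \<alpha> (v x) t"
      using caputo_eq[OF t(2)] by simp
    finally show ?case by (simp add: L1_residual_def t_def)
  qed
qed

section \<open>Estimates on the grid intervals and their sum\<close>

text \<open>The factors are \<open>\<tau>\<close> for the length of the interval, \<open>C * \<tau> * a powr (\<sigma> - 2)\<close> for the deviation of
the slope and \<open>\<alpha> * \<tau> * (t - b) powr (- \<alpha> - 1)\<close> for the increment of the kernel.\<close>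

lemma L2_bound_local_error_middle:
  assumes \<alpha>: "0 < \<alpha>" and \<tau>: "0 < \<tau>" and n: "real n * \<tau> \<le> T"
    and j: "2 \<le> j" "j < n"
  shows "L2_bound M (local_error \<alpha> \<tau> n j)
    (\<alpha> * C * \<tau> powr (\<sigma> - \<alpha>) * (real (j - 1) powr (- (2 - \<sigma>)) * real (n - j) powr (- (1 + \<alpha>))))"
    (is "L2_bound M _ ?B")
proof -
  define a b t where "a = real (j - 1) * \<tau>" and "b = real j * \<tau>" and "t = real n * \<tau>"
  have ab: "0 < a" "a < b" "b < t" "b \<le> T" "b - a = \<tau>" and tb: "t - b = real (n - j) * \<tau>"
    using j \<tau> n grid_point_le[of j n \<tau>] by (auto simp: a_def b_def t_def of_nat_diff algebra_simps)
  define w where "w = \<alpha> * (b - a) * (t - b) powr (- \<alpha> - 1) * (C * (b - a) * a powr (\<sigma> - 2))"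
  have W: "\<tau> * w = ?B"
  proof -
    have "\<tau> * w = \<alpha> * C * (\<tau> powr 1 * \<tau> powr 1 * \<tau> powr 1 * \<tau> powr (\<sigma> - 2) * \<tau> powr (- \<alpha> - 1)) *
        (real (j - 1) powr (\<sigma> - 2) * real (n - j) powr (- \<alpha> - 1))"
      unfolding w_def ab(5) tb unfolding a_def using \<tau> by (simp add: powr_mult)
    also have "\<tau> powr 1 * \<tau> powr 1 * \<tau> powr 1 * \<tau> powr (\<sigma> - 2) * \<tau> powr (- \<alpha> - 1) = \<tau> powr (\<sigma> - \<alpha>)"
      unfolding powr_add[symmetric] by (simp add: algebra_simps)
    finally show ?thesis by (simp add: minus_diff_commute)
  qed
  have w: "0 < w" using \<alpha> ab C_pos by (simp add: w_def)
  have "L2_bound M (\<lambda>x. LBINT s:{a<..<b}. ((v x b - v x a) / (b - a) - v1 x s) *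
      ((t - s) powr (- \<alpha>) - (t - a) powr (- \<alpha>))) (\<tau> * w)"
  proof (rule L2_bound_kernel_term)
    show "L2_bound M (\<lambda>x. (v x b - v x a) / (b - a) - v1 x s) (C * (b - a) * a powr (\<sigma> - 2))"
      if "s \<in> {a<..<b}" for s
      using ab that by (intro L2_bound_slope_deviation) auto
    show "((t - s) powr (- \<alpha>) - (t - a) powr (- \<alpha>)) * (C * (b - a) * a powr (\<sigma> - 2)) \<le> w"
      if "s \<in> {a<..<b}" for s
      unfolding w_def using powr_kernel_increment(2)[of \<alpha> a s b t] that \<alpha> ab C_pos
      by (intro mult_right_mono) auto
  qed (use ab \<alpha> \<tau> w powr_kernel_increment(1)[of \<alpha> a _ b t] in \<open>auto simp: set_integral_Ioo_const simp del: set_integral_mult_right set_integral_mult_left\<close>)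
  then show ?thesis
    unfolding W local_error_def[abs_def] a_def[symmetric] b_def[symmetric] t_def[symmetric]
    using j ab by simp
qed

lemma L2_bound_local_error_last:
  assumes \<alpha>: "\<alpha> < 1" and \<tau>: "0 < \<tau>" and n: "2 \<le> n" "real n * \<tau> \<le> T"
  shows "L2_bound M (local_error \<alpha> \<tau> n n)
    (C / (1 - \<alpha>) * \<tau> powr (\<sigma> - \<alpha>) * real (n - 1) powr (- (2 - \<sigma>)))"
    (is "L2_bound M _ ?B")
proof -
  define a t where "a = real (n - 1) * \<tau>" and "t = real n * \<tau>"
  have ab: "0 < a" "a < t" "t \<le> T" "t - a = \<tau>"
    using \<tau> n by (auto simp: a_def t_def of_nat_diff algebra_simps)
  define K where "K = C * (t - a) * a powr (\<sigma> - 2)"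
  have K: "0 < K" using ab C_pos by (simp add: K_def)
  note int_k = abel_kernel_integral[OF \<alpha> less_imp_le[OF ab(2)] order_refl]
  have W: "(LBINT s:{a<..<t}. (t - s) powr (- \<alpha>) * K) = ?B"
  proof -
    have "(LBINT s:{a<..<t}. (t - s) powr (- \<alpha>) * K) = \<tau> powr (1 - \<alpha>) / (1 - \<alpha>) * K"
      by (simp add: int_k(2) ab(4))
    also have "\<dots> = C / (1 - \<alpha>) * (\<tau> powr (1 - \<alpha>) * \<tau> powr 1 * \<tau> powr (\<sigma> - 2)) * real (n - 1) powr (\<sigma> - 2)"
      unfolding K_def ab(4) unfolding a_def using \<tau> by (simp add: powr_mult)
    also have "\<tau> powr (1 - \<alpha>) * \<tau> powr 1 * \<tau> powr (\<sigma> - 2) = \<tau> powr (\<sigma> - \<alpha>)"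
      unfolding powr_add[symmetric] by (simp add: algebra_simps)
    finally show ?thesis by simp
  qed
  have "L2_bound M (\<lambda>x. LBINT s:{a<..<t}. ((v x t - v x a) / (t - a) - v1 x s) * (t - s) powr (- \<alpha>)) ?B"
  proof (rule L2_bound_kernel_term)
    show "L2_bound M (\<lambda>x. (v x t - v x a) / (t - a) - v1 x s) K" if "s \<in> {a<..<t}" for s
      unfolding K_def using ab that by (intro L2_bound_slope_deviation) auto
    show "(LBINT s:{a<..<t}. (t - s) powr (- \<alpha>) * K) = ?B" by (rule W)
    show "set_integrable lborel {a<..<t} (\<lambda>s. (t - s) powr (- \<alpha>) * K)"
      using int_k(1) by simp
    show "0 < ?B" using C_pos \<alpha> \<tau> n by simp
  qed (use ab in auto)
  then show ?thesis
    unfolding local_error_def[abs_def] a_def[symmetric] t_def[symmetric] using ab by simp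
qed

lemma L2_bound_local_error_first:
  assumes \<alpha>: "0 < \<alpha>" and \<tau>: "0 < \<tau>" and n: "2 \<le> n" "real n * \<tau> \<le> T"
  shows "L2_bound M (local_error \<alpha> \<tau> n 1)
    (2 * \<alpha> * C / \<sigma> * \<tau> powr (\<sigma> - \<alpha>) * real (n - 1) powr (- (1 + \<alpha>)))"
    (is "L2_bound M _ ?B")
proof -
  define t where "t = real n * \<tau>"
  have t: "\<tau> < t" "t \<le> T" "\<tau> \<le> T" and t\<tau>: "t - \<tau> = real (n - 1) * \<tau>"
    using \<tau> n grid_point_le[of 1 n \<tau>] by (auto simp: t_def of_nat_diff algebra_simps)
  define \<rho> where "\<rho> s = C * \<tau> powr (\<sigma> - 1) / \<sigma> + C * s powr (\<sigma> - 1)" for s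
  define K where "K = \<alpha> * \<tau> * (t - \<tau>) powr (- \<alpha> - 1)"
  note int1 = power_singularity_integral[OF \<sigma>_pos less_imp_le[OF \<tau>]]
  have int: "set_integrable lborel {0<..<\<tau>} \<rho>"
    unfolding \<rho>_def using int1(1) by (intro set_integral_add(1) set_integral_Ioo_const) auto
  have W: "(LBINT s:{0<..<\<tau>}. K * \<rho> s) = ?B"
  proof -
    have "(LBINT s:{0<..<\<tau>}. \<rho> s) = \<tau> * (C * \<tau> powr (\<sigma> - 1) / \<sigma>) + C * (\<tau> powr \<sigma> / \<sigma>)"
      unfolding \<rho>_def using int1 \<tau> set_integral_Ioo_const(2)[of 0 \<tau>]
      by (subst set_integral_add(2)) (auto intro: set_integral_Ioo_const)
    also have "\<dots> = 2 * C / \<sigma> * \<tau> powr \<sigma>"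
      using \<tau> by (simp add: powr_diff)
    finally have "(LBINT s:{0<..<\<tau>}. K * \<rho> s) = K * (2 * C / \<sigma> * \<tau> powr \<sigma>)" by simp
    also have "\<dots> = 2 * \<alpha> * C / \<sigma> * (\<tau> powr 1 * \<tau> powr (- \<alpha> - 1) * \<tau> powr \<sigma>) * real (n - 1) powr (- \<alpha> - 1)"
      unfolding K_def t\<tau> using \<tau> by (simp add: powr_mult)
    also have "\<tau> powr 1 * \<tau> powr (- \<alpha> - 1) * \<tau> powr \<sigma> = \<tau> powr (\<sigma> - \<alpha>)"
      unfolding powr_add[symmetric] by (simp add: algebra_simps)
    finally show ?thesis by (simp add: minus_diff_commute)
  qed
  have "L2_bound M (\<lambda>x. LBINT s:{0<..<\<tau>}. ((v x \<tau> - v x 0) / (\<tau> - 0) - v1 x s) *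
      ((t - s) powr (- \<alpha>) - (t - 0) powr (- \<alpha>))) ?B"
  proof (rule L2_bound_kernel_term)
    show "L2_bound M (\<lambda>x. (v x \<tau> - v x 0) / (\<tau> - 0) - v1 x s) (\<rho> s)" if "s \<in> {0<..<\<tau>}" for s
      using L2_bound_slope_deviation_first[OF \<tau> t(3) that] by (simp add: \<rho>_def)
    show "((t - s) powr (- \<alpha>) - (t - 0) powr (- \<alpha>)) * \<rho> s \<le> K * \<rho> s" if "s \<in> {0<..<\<tau>}" for s
      unfolding K_def \<rho>_def
      using powr_kernel_increment(2)[of \<alpha> 0 s \<tau> t] that \<alpha> t C_pos \<sigma>_pos
      by (intro mult_right_mono) auto
    show "(LBINT s:{0<..<\<tau>}. K * \<rho> s) = ?B" by (rule W)
    show "set_integrable lborel {0<..<\<tau>} (\<lambda>s. K * \<rho> s)" using int by simp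
    show "0 < ?B" using C_pos \<alpha> \<tau> n \<sigma>_pos by simp
    show "0 < (t - s) powr (- \<alpha>) - (t - 0) powr (- \<alpha>)" if "s \<in> {0<..<\<tau>}" for s
      using powr_kernel_increment(1)[of \<alpha> 0 s \<tau> t] that \<alpha> t by simp
  qed (use t \<tau> in auto)
  then show ?thesis
    unfolding local_error_def[abs_def] t_def[symmetric] using n by simp
qed

text \<open>For \<open>n = 1\<close> the singularities of the path and of the kernel lie at the two ends of the same
interval.\<close>

lemma L2_bound_local_error_single:
  assumes \<alpha>: "0 < \<alpha>" "\<alpha> < 1" and \<tau>: "0 < \<tau>" "\<tau> \<le> T"
  shows "L2_bound M (local_error \<alpha> \<tau> 1 1)
    (C * (1 / (\<sigma> * (1 - \<alpha>)) + 2 powr \<alpha> / \<sigma> + 2 / (1 - \<alpha>)) * \<tau> powr (\<sigma> - \<alpha>))"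
    (is "L2_bound M _ ?B")
proof -
  define w where "w s = C * (\<tau> / 2) powr (- \<alpha>) * s powr (\<sigma> - 1)
      + C * (1 / \<sigma> + 2) * \<tau> powr (\<sigma> - 1) * (\<tau> - s) powr (- \<alpha>)" for s
  note int1 = power_singularity_integral[OF \<sigma>_pos less_imp_le[OF \<tau>(1)]]
  note int2 = abel_kernel_integral[OF \<open>\<alpha> < 1\<close> less_imp_le[OF \<tau>(1)] order_refl]
  have int: "set_integrable lborel {0<..<\<tau>} w"
    unfolding w_def using int1(1) int2(1) by (intro set_integral_add(1)) auto
  have W: "(LBINT s:{0<..<\<tau>}. w s) = ?B"
  proof -
    have "(LBINT s:{0<..<\<tau>}. w s) = C * (\<tau> / 2) powr (- \<alpha>) * (\<tau> powr \<sigma> / \<sigma>)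
        + C * (1 / \<sigma> + 2) * \<tau> powr (\<sigma> - 1) * (\<tau> powr (1 - \<alpha>) / (1 - \<alpha>))"
      unfolding w_def using int1 int2 by (subst set_integral_add(2)) auto
    also have "\<dots> = C * (2 powr \<alpha> / \<sigma>) * (\<tau> powr (- \<alpha>) * \<tau> powr \<sigma>)
        + C * ((1 / \<sigma> + 2) / (1 - \<alpha>)) * (\<tau> powr (\<sigma> - 1) * \<tau> powr (1 - \<alpha>))"
      using \<tau> by (simp add: divide_powr_minus)
    also have "\<dots> = C * (2 powr \<alpha> / \<sigma>) * \<tau> powr (\<sigma> - \<alpha>) + C * ((1 / \<sigma> + 2) / (1 - \<alpha>)) * \<tau> powr (\<sigma> - \<alpha>)"
      unfolding powr_add[symmetric] by simp
    also have "\<dots> = ?B"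
      using \<alpha> by (simp add: distrib_left distrib_right add_divide_distrib)
    finally show ?thesis .
  qed
  have "L2_bound M (\<lambda>x. LBINT s:{0<..<\<tau>}. ((v x \<tau> - v x 0) / (\<tau> - 0) - v1 x s) * (\<tau> - s) powr (- \<alpha>)) ?B"
  proof (rule L2_bound_kernel_term)
    show "L2_bound M (\<lambda>x. (v x \<tau> - v x 0) / (\<tau> - 0) - v1 x s)
        (C * \<tau> powr (\<sigma> - 1) / \<sigma> + C * s powr (\<sigma> - 1))" if "s \<in> {0<..<\<tau>}" for s
      using L2_bound_slope_deviation_first[OF \<tau> that] by simp
    show "(\<tau> - s) powr (- \<alpha>) * (C * \<tau> powr (\<sigma> - 1) / \<sigma> + C * s powr (\<sigma> - 1)) \<le> w s"
      if "s \<in> {0<..<\<tau>}" for s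
      using mult_left_mono[OF beta_integrand_bound[of \<alpha> \<sigma> s \<tau>], of C] that \<alpha> \<sigma>_pos C_pos
      by (simp add: w_def algebra_simps)
    show "(LBINT s:{0<..<\<tau>}. w s) = ?B" by (rule W)
    show "0 < ?B"
      using C_pos \<alpha> \<tau> \<sigma>_pos by (intro mult_pos_pos add_pos_pos divide_pos_pos) auto
  qed (use int \<tau> in auto)
  then show ?thesis
    unfolding local_error_def[abs_def] by simp
qed

text \<open>The contributions of the grid intervals are added up. The convolution of the two powers from the
middle intervals and the two boundary terms all decay at the rate \<open>min (1 + \<alpha>) (2 - \<sigma>)\<close>.\<close>

theorem L2_bound_L1_residual:
  assumes \<alpha>: "0 < \<alpha>" "\<alpha> < 1"
  shows "\<exists>c>0. \<forall>n \<tau>. 1 \<le> n \<and> 0 < \<tau> \<and> real n * \<tau> \<le> T \<longrightarrow>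
    L2_bound M (L1_residual \<alpha> \<tau> v n) (c * (\<tau> powr (\<sigma> - \<alpha>) * real n powr (- min (1 + \<alpha>) (2 - \<sigma>))))"
proof -
  define r where "r = min (1 + \<alpha>) (2 - \<sigma>)"
  define Z where "Z = (\<Sum>k. real (Suc k) powr (- (1 + \<alpha>)))"
  define c1 where "c1 = C * (1 / (\<sigma> * (1 - \<alpha>)) + 2 powr \<alpha> / \<sigma> + 2 / (1 - \<alpha>))"
  define c2 where "c2 = 4 * (2 * \<alpha> * C / \<sigma>) + 32 * \<alpha> * C * Z + 4 * (C / (1 - \<alpha>))"
  have r: "0 \<le> r" "r \<le> 2" using \<alpha> \<sigma>_le by (auto simp: r_def)
  have G: "0 < Gamma (1 - \<alpha>)" using \<alpha> by (simp add: Gamma_real_pos)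
  have c1: "0 < c1"
    unfolding c1_def using C_pos \<alpha> \<sigma>_pos by (intro mult_pos_pos add_pos_pos divide_pos_pos) auto
  have Z: "0 \<le> Z"
    unfolding Z_def using \<alpha>
    by (intro suminf_nonneg summable_Suc_powr) auto
  have c2: "0 < c2"
    unfolding c2_def using C_pos \<alpha> \<sigma>_pos Z by (intro add_nonneg_pos add_nonneg_nonneg) auto
  have sum_bound: "L2_bound M (\<lambda>x. \<Sum>j=1..n. local_error \<alpha> \<tau> n j x)
      ((c1 + c2) * (\<tau> powr (\<sigma> - \<alpha>) * real n powr (- r)))"
    if n: "1 \<le> n" and \<tau>: "0 < \<tau>" "real n * \<tau> \<le> T" for n \<tau>
  proof (cases "n = 1")
    case True
    have "L2_bound M (local_error \<alpha> \<tau> 1 1) (c1 * \<tau> powr (\<sigma> - \<alpha>))"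
      using L2_bound_local_error_single[OF \<alpha> \<tau>(1)] \<tau> True by (simp add: c1_def)
    then have "L2_bound M (local_error \<alpha> \<tau> 1 1) ((c1 + c2) * \<tau> powr (\<sigma> - \<alpha>))"
      by (rule L2_bound_mono) (use c2 in \<open>auto intro: mult_right_mono\<close>)
    then show ?thesis using True by simp
  next
    case False
    then have n2: "2 \<le> n" using n by simp
    define S where "S = \<tau> powr (\<sigma> - \<alpha>)"
    have S: "0 \<le> S" by (simp add: S_def)
    \<comment> \<open>The estimates on the intervals are in terms of \<open>n - 1\<close>, which is at least
      \<open>n / 2\<close>. As \<open>r \<le> 2\<close>, this costs at most the factors
      \<open>4\<^sup>2\<close> and \<open>2\<^sup>2\<close>.\<close>
    have n1: "(real (n - 1) / 2) powr (- r) \<le> 16 * real n powr (- r)"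
      "real (n - 1) powr (- r) \<le> 4 * real n powr (- r)"
    proof -
      have "(real (n - 1) / 2) powr (- r) \<le> (real n / 4) powr (- r)"
        using n2 r by (intro powr_mono2') (auto simp: of_nat_diff)
      also have "\<dots> = 4 powr r * real n powr (- r)"
        by (simp add: divide_powr_minus)
      also have "\<dots> \<le> 16 * real n powr (- r)"
        using powr_mono[of r 2 "4::real"] r by (intro mult_right_mono) auto
      finally show "(real (n - 1) / 2) powr (- r) \<le> 16 * real n powr (- r)" .
      have "real (n - 1) powr (- r) \<le> (real n / 2) powr (- r)"
        using n2 r by (intro powr_mono2') (auto simp: of_nat_diff)
      also have "\<dots> = 2 powr r * real n powr (- r)"
        by (simp add: divide_powr_minus)
      also have "\<dots> \<le> 4 * real n powr (- r)"
        using powr_mono[of r 2 "2::real"] r by (intro mult_right_mono) auto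
      finally show "real (n - 1) powr (- r) \<le> 4 * real n powr (- r)" .
    qed
    have weaker: "real (n - 1) powr (- p) \<le> 4 * real n powr (- r)" if "r \<le> p" for p
      using powr_mono[of "- p" "- r" "real (n - 1)"] n1(2) n2 that by simp
    define B where "B j = (if j = 1 then 2 * \<alpha> * C / \<sigma> * S * real (n - 1) powr (- (1 + \<alpha>))
        else if j < n then \<alpha> * C * S * (real (j - 1) powr (- (2 - \<sigma>)) * real (n - j) powr (- (1 + \<alpha>)))
        else C / (1 - \<alpha>) * S * real (n - 1) powr (- (2 - \<sigma>)))" for j
    have "L2_bound M (\<lambda>x. \<Sum>j=1..n. local_error \<alpha> \<tau> n j x) (\<Sum>j=1..n. B j)"
    proof (rule L2_bound_sum)
      fix j assume j: "j \<in> {1..n}"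
      then consider "j = 1" | "2 \<le> j" "j < n" | "j = n" "2 \<le> j" using n2 by fastforce
      then show "L2_bound M (local_error \<alpha> \<tau> n j) (B j)"
      proof cases
        case 1
        then show ?thesis
          using L2_bound_local_error_first[OF \<alpha>(1) \<tau>(1) n2 \<tau>(2)] by (simp add: B_def S_def)
      next
        case 2
        then show ?thesis
          using L2_bound_local_error_middle[OF \<alpha>(1) \<tau> 2] by (simp add: B_def S_def)
      next
        case 3
        then show ?thesis
          using L2_bound_local_error_last[OF \<alpha>(2) \<tau>(1) n2 \<tau>(2)] by (simp add: B_def S_def)
      qed
    qed (use n in auto)
    moreover have "(\<Sum>j=1..n. B j) \<le> (c1 + c2) * (S * real n powr (- r))"
    proof -
      have "{1..n} = insert 1 (insert n {2..<n})" using n2 by auto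
      then have "(\<Sum>j=1..n. B j) = B 1 + (B n + (\<Sum>j=2..<n. B j))"
        using n2 by simp
      also have "B 1 \<le> 2 * \<alpha> * C / \<sigma> * S * (4 * real n powr (- r))"
        unfolding B_def using weaker[of "1 + \<alpha>"] \<alpha> C_pos \<sigma>_pos S
        by (simp only: if_True simp_thms) (intro mult_left_mono; simp add: r_def)
      also have "B n \<le> C / (1 - \<alpha>) * S * (4 * real n powr (- r))"
      proof -
        have "B n = C / (1 - \<alpha>) * S * real (n - 1) powr (- (2 - \<sigma>))"
          using n2 by (simp add: B_def)
        also have "\<dots> \<le> C / (1 - \<alpha>) * S * (4 * real n powr (- r))"
          using weaker[of "2 - \<sigma>"] \<alpha> C_pos S by (intro mult_left_mono) (auto simp: r_def)
        finally show ?thesis .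
      qed
      also have "(\<Sum>j=2..<n. B j) \<le> \<alpha> * C * S * (32 * Z * real n powr (- r))"
      proof -
        have "(\<Sum>j=2..<n. B j) = (\<Sum>j=2..<n. \<alpha> * C * S *
            (real (j - 1) powr (- (2 - \<sigma>)) * real (n - j) powr (- (1 + \<alpha>))))"
          by (rule sum.cong) (auto simp: B_def)
        also have "\<dots> = \<alpha> * C * S * (\<Sum>j=2..<n. real (j - 1) powr (- (2 - \<sigma>)) * real (n - j) powr (- (1 + \<alpha>)))"
          by (simp only: sum_distrib_left)
        also have "(\<Sum>j=2..<n. real (j - 1) powr (- (2 - \<sigma>)) * real (n - j) powr (- (1 + \<alpha>)))
            = (\<Sum>i=1..<n - 1. real i powr (- (2 - \<sigma>)) * real (n - 1 - i) powr (- (1 + \<alpha>)))"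
          by (rule sum.reindex_bij_witness[of _ Suc "\<lambda>j. j - 1"]) auto
        also have "\<dots> \<le> 2 * Z * (real (n - 1) / 2) powr (- r)"
          using powr_convolution_le[of "1 + \<alpha>" "2 - \<sigma>" "n - 1"] \<alpha> \<sigma>_le by (simp add: Z_def r_def)
        also have "\<dots> \<le> 2 * Z * (16 * real n powr (- r))"
          using n1(1) Z by (intro mult_left_mono) auto
        finally show ?thesis
          using \<alpha> C_pos S by (simp add: mult_left_mono)
      qed
      also have "2 * \<alpha> * C / \<sigma> * S * (4 * real n powr (- r)) + (C / (1 - \<alpha>) * S * (4 * real n powr (- r))
          + \<alpha> * C * S * (32 * Z * real n powr (- r))) = c2 * (S * real n powr (- r))"
        by (simp add: c2_def distrib_left distrib_right mult_ac)
      also have "\<dots> \<le> (c1 + c2) * (S * real n powr (- r))"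
        using c1 S by (intro mult_right_mono) auto
      finally show ?thesis by simp
    qed
    ultimately show ?thesis unfolding S_def by (rule L2_bound_mono)
  qed
  show ?thesis
  proof (intro exI[of _ "1 / Gamma (1 - \<alpha>) * (c1 + c2)"] conjI allI impI; (elim conjE)?)
    show "0 < 1 / Gamma (1 - \<alpha>) * (c1 + c2)" using G c1 c2 by simp
    fix n \<tau> assume n: "1 \<le> n" and \<tau>: "0 < \<tau>" "real n * \<tau> \<le> T"
    have "L2_bound M (\<lambda>x. 1 / Gamma (1 - \<alpha>) * (\<Sum>j=1..n. local_error \<alpha> \<tau> n j x))
        (1 / Gamma (1 - \<alpha>) * (c1 + c2) * (\<tau> powr (\<sigma> - \<alpha>) * real n powr (- r)))"
      using L2_bound_cmult[OF sum_bound[OF n \<tau>], of "1 / Gamma (1 - \<alpha>)"] G by simp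
    then show "L2_bound M (L1_residual \<alpha> \<tau> v n) (1 / Gamma (1 - \<alpha>) * (c1 + c2) *
        (\<tau> powr (\<sigma> - \<alpha>) * real n powr (- min (1 + \<alpha>) (2 - \<sigma>))))"
      unfolding r_def
      by (rule L2_bound_cong_AE)
         (use L1_residual_measurable[OF \<tau>] L1_residual_eq_local_errors[OF \<alpha> \<tau>(1) n \<tau>(2)] in \<open>auto elim: eventually_mono\<close>)
  qed
qed

end

section \<open>The estimate on the cube\<close>

lemma L2_bound_imp_L2_norm_on:
  assumes "L2_bound (lebesgue_on S) f B"
  shows "f \<in> L2_space S" and "L2_norm_on S f \<le> B"
proof -
  note [measurable] = L2_boundD(2)[OF assms]
  have fin: "(\<integral>\<^sup>+x. ennreal ((f x)\<^sup>2) \<partial>lebesgue_on S) < \<infinity>"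
    using L2_boundD(3)[OF assms] by (rule order.strict_trans1) simp
  then have int: "integrable (lebesgue_on S) (\<lambda>x. (f x)\<^sup>2)"
    by (intro integrableI_nonneg) auto
  then show "f \<in> L2_space S" by (simp add: L2_space_def)
  have "ennreal (LINT x|lebesgue_on S. (f x)\<^sup>2) \<le> ennreal (B\<^sup>2)"
    using L2_boundD(3)[OF assms] by (simp add: nn_integral_eq_integral[OF int])
  then have "(LINT x|lebesgue_on S. (f x)\<^sup>2) \<le> B\<^sup>2" by (simp add: ennreal_le_iff)
  then show "L2_norm_on S f \<le> B"
    using L2_boundD(1)[OF assms] unfolding L2_norm_on_def
    by (intro real_le_lsqrt) auto
qed

lemma L2_boundI_L2_norm_on:
  assumes "f \<in> L2_space S" "L2_norm_on S f \<le> B" "0 < B"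
  shows "L2_bound (lebesgue_on S) f B"
proof -
  have int: "integrable (lebesgue_on S) (\<lambda>x. (f x)\<^sup>2)" and f: "f \<in> borel_measurable (lebesgue_on S)"
    using assms(1) by (auto simp: L2_space_def)
  have "(LINT x|lebesgue_on S. (f x)\<^sup>2) \<le> B\<^sup>2"
    using assms(2) unfolding L2_norm_on_def by (rule sqrt_le_D)
  then show ?thesis
    using f assms(3) by (simp add: L2_bound_def nn_integral_eq_integral[OF int] ennreal_leI)
qed

theorem lemma2p1:
  fixes \<alpha> \<sigma> L T C :: real
    and u :: "real ^ 'd \<Rightarrow> real \<Rightarrow> real"
    and \<Omega> :: "(real ^ 'd) set"
  assumes "0 < \<alpha>" and "\<alpha> < 1"
    and "\<sigma> \<in> {0<..<1} \<union> {1<..2}"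
    and "0 < L" and "0 < T"
    and "\<Omega> = {x. \<forall>i. 0 < x $ i \<and> x $ i < L}"
    and "\<And>x. x \<in> \<Omega> \<Longrightarrow> continuous_on {0..T} (u x)"
    and "\<And>x t. x \<in> \<Omega> \<Longrightarrow> t \<in> {0<..<T} \<Longrightarrow> u x differentiable (at t)"
    and "\<And>x t. x \<in> \<Omega> \<Longrightarrow> t \<in> {0<..<T} \<Longrightarrow> deriv (u x) differentiable (at t)"
    and "\<And>m t. m \<in> {1, 2} \<Longrightarrow> t \<in> {0<..<T} \<Longrightarrow>
           (\<lambda>x. (deriv ^^ m) (u x) t) \<in> L2_space \<Omega> \<and>
           L2_norm_on \<Omega> (\<lambda>x. (deriv ^^ m) (u x) t) \<le> C * t powr (\<sigma> - real m)"
  shows "\<exists>c>0. \<forall>N\<ge>1. \<forall>n\<in>{1..N}. \<forall>\<tau>. \<tau> = T / real N \<longrightarrow>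
           L1_residual \<alpha> \<tau> u n \<in> L2_space \<Omega> \<and>
           (0 < \<sigma> \<and> \<sigma> < 1 \<longrightarrow> L2_norm_on \<Omega> (L1_residual \<alpha> \<tau> u n)
              \<le> c * (\<tau> powr (\<sigma> - \<alpha>) * real n powr (- min (1 + \<alpha>) (2 - \<sigma>)))) \<and>
           (1 < \<sigma> \<and> \<sigma> < 2 \<longrightarrow> L2_norm_on \<Omega> (L1_residual \<alpha> \<tau> u n)
              \<le> c * (\<tau> powr (\<sigma> - \<alpha>) * real n powr (- 2 + \<sigma>)))"
proof -
  have box: "\<Omega> = box 0 (\<chi> i. L)"
    using assms(6) by (auto simp: mem_box_cart)
  have fin: "\<Omega> \<in> lmeasurable" by (simp add: box)
  \<comment> \<open>The bounds in \<open>L2_bound\<close> are strictly positive, so \<open>C\<close> is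
    enlarged to a positive constant.\<close>
  define K where "K = max C 1"
  have bd: "L2_bound (lebesgue_on \<Omega>) (\<lambda>x. (deriv ^^ m) (u x) t) (K * t powr (\<sigma> - real m))"
    if "m \<in> {1, 2}" "t \<in> {0<..<T}" for m t
  proof (rule L2_boundI_L2_norm_on)
    have "C * t powr (\<sigma> - real m) \<le> K * t powr (\<sigma> - real m)"
      by (intro mult_right_mono) (auto simp: K_def)
    then show "L2_norm_on \<Omega> (\<lambda>x. (deriv ^^ m) (u x) t) \<le> K * t powr (\<sigma> - real m)"
      using assms(10)[OF that] by linarith
  qed (use assms(10)[OF that] that in \<open>auto simp: K_def\<close>)
  interpret L2_singular_path "lebesgue_on \<Omega>" u K \<sigma> T
  proof (rule L2_singular_path.intro)
    show "sigma_finite_measure (lebesgue_on \<Omega>)"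
      using finite_measure_lebesgue_on[OF fin] by (simp add: finite_measure_def)
    show "L2_bound (lebesgue_on \<Omega>) (\<lambda>x. deriv (u x) t) (K * t powr (\<sigma> - 1))"
      if "t \<in> {0<..<T}" for t
      using bd[of 1 t] that by simp
    show "L2_bound (lebesgue_on \<Omega>) (\<lambda>x. deriv (deriv (u x)) t) (K * t powr (\<sigma> - 2))"
      if "t \<in> {0<..<T}" for t
      using bd[of 2 t] that by (simp add: numeral_2_eq_2)
  qed (use assms in \<open>auto simp: space_restrict_space\<close>)
  obtain c where c: "0 < c" and res: "\<And>n \<tau>. 1 \<le> n \<and> 0 < \<tau> \<and> real n * \<tau> \<le> T \<Longrightarrow>
      L2_bound (lebesgue_on \<Omega>) (L1_residual \<alpha> \<tau> u n)
        (c * (\<tau> powr (\<sigma> - \<alpha>) * real n powr (- min (1 + \<alpha>) (2 - \<sigma>))))"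
    using L2_bound_L1_residual[OF assms(1,2)] by blast
  have min2: "- min (1 + \<alpha>) (2 - \<sigma>) = - 2 + \<sigma>" if "1 < \<sigma>"
    using that assms(1) by simp
  show ?thesis
  proof (intro exI[of _ c] conjI c allI impI ballI)
    fix N n \<tau> assume N: "1 \<le> N" and n: "n \<in> {1..N}" and \<tau>: "\<tau> = T / real N"
    have "real n * \<tau> \<le> real N * \<tau>"
      using n N \<tau> assms(5) by (intro mult_right_mono) auto
    then have "1 \<le> n \<and> 0 < \<tau> \<and> real n * \<tau> \<le> T"
      using n N \<tau> assms(5) by simp
    note bound = L2_bound_imp_L2_norm_on[OF res[OF this]]
    show "L1_residual \<alpha> \<tau> u n \<in> L2_space \<Omega>"
      by (rule bound)
    show "L2_norm_on \<Omega> (L1_residual \<alpha> \<tau> u n)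
        \<le> c * (\<tau> powr (\<sigma> - \<alpha>) * real n powr (- min (1 + \<alpha>) (2 - \<sigma>)))"
      by (rule bound)
    show "L2_norm_on \<Omega> (L1_residual \<alpha> \<tau> u n)
        \<le> c * (\<tau> powr (\<sigma> - \<alpha>) * real n powr (- 2 + \<sigma>))" if "1 < \<sigma> \<and> \<sigma> < 2"
      using bound(2) min2 that by simp
  qed
qed

end
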